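(* Let $X$ be a non-compact proper Busemann space. Let the ideal points $[\Phi],[\Psi]\in\partial_hX$ and $\zeta\in\partial_gX$ be such that $\operatorname{Td}([\Phi],\zeta)\le\pi/2$ and $\operatorname{Td}([\Psi],\zeta)\le\pi/2$. Let $\xi=\pi_{hg}([\Phi])$ and $\eta=\pi_{hg}([\Psi])$. Then $\operatorname{Td}(\xi,\eta)\le\pi$.
   Context: Busemann space: a geodesic metric space $X$ (distance written $|xy|$) such that for any two geodesic segments with affine parameterizations $\gamma:[a,b]\to X$, $\gamma':[a',b']\to X$ the function $(t,t')\mapsto|\gamma(t)\gamma'(t')|$ is convex. Proper means closed balls are compact. A ray is a distance-preserving map $c:\mathbb{R}_+=[0,\infty)\to X$. Two rays are asymptotic if the Hausdorff distance between their images is finite; $\partial_gX$ (geodesic boundary) is the set of asymptoticity classes of rays, and $c(+\infty)$ denotes the class of $c$. For each $x\in X$, $\xi\in\partial_gX$ there is a unique ray $[x\xi]$ starting at $x$ in the class $\xi$. Geodesic compactification $\overline{X}_g=X\cup\partial_gX$ with the cone topology: fixing $o\in X$, a sequence $x_i\in\overline{X}_g$ converges to $x\in\overline{X}_g$ iff $|ox_i|\to|ox|$ (with $|ox|=\infty$ for $x\in\partial_gX$) and the naturally parameterized segments/rays $[ox_i]$ converge to $[ox]$ (uniformly on bounded sets). It is compact and independent of $o$. On $\partial_gX$ a base of neighbourhoods of $\xi$ is given by $\{\eta\in\partial_gX : |c_\xi(K)c_\eta(K)|<1\}$, $K>0$, where $c_\xi=[o\xi]$, $c_\eta=[o\eta]$.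 Horofunction compactification: let $C(X,\mathbb{R})$ be the continuous functions with the topology of uniform convergence on bounded sets and $C^*(X,\mathbb{R})=C(X,\mathbb{R})/\{\text{constants}\}$; embed $X$ into $C^*(X,\mathbb{R})$ by $x\mapsto$ class of $y\mapsto|xy|$; $\overline{X}_h$ is the closure of the image and $\partial_hX=\overline{X}_h\setminus X$. A horofunction is a function $\Phi:X\to\mathbb{R}$ whose class $[\Phi]$ modulo constants lies in $\partial_hX$. The identity of $X$ extends to a continuous surjection $\pi_{hg}:\overline{X}_h\to\overline{X}_g$, mapping $\partial_hX$ onto $\partial_gX$. The symbol $\operatorname{Td}$ is not a metric; it denotes binary relations. On $\partial_hX\times\partial_gX$: $\operatorname{Td}([\Phi],\xi)\le\pi/2$ means that $\Phi$ is non-increasing on some (equivalently, every) ray $c$ with $c(+\infty)=\xi$, i.e. $\Phi\circ c$ is non-increasing on $\mathbb{R}_+$. On $\partial_gX\times\partial_gX$: for $c=[o\xi]$, $d=[o\eta]$ put $\delta_o(\xi,\eta)=\lim_{t\to+\infty}\frac{|c(t)d(t)|}{2t}\le1$ (independent of $o$); $\operatorname{Td}(\xi,\eta)<\pi$ means $\delta_o(\xi,\eta)<1$; $\operatorname{Td}(\xi,\eta)\le\pi$ means that for any neighbourhoods $U$ of $\xi$ and $V$ of $\eta$ in the cone topology there are $\xi'\in U$, $\eta'\in V$ with $\operatorname{Td}(\xi',\eta')<\pi$. *)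

theory Defs
  imports "HOL-Analysis.Analysis"
begin

section \<open>Busemann spaces\<close>

text \<open>Paths are total functions on the reals, of which only the values on the stated domain matter.\<close>

definition affine_geodesic_on :: "real \<Rightarrow> real \<Rightarrow> (real \<Rightarrow> 'a::metric_space) \<Rightarrow> bool" where
  "affine_geodesic_on a b \<gamma> \<longleftrightarrow>
     (\<exists>v\<ge>0. \<forall>s\<in>{a..b}. \<forall>t\<in>{a..b}. dist (\<gamma> s) (\<gamma> t) = v * \<bar>s - t\<bar>)"

definition natural_geodesic :: "'a \<Rightarrow> 'a \<Rightarrow> (real \<Rightarrow> 'a::metric_space) \<Rightarrow> bool" where
  "natural_geodesic x y \<gamma> \<longleftrightarrow> \<gamma> 0 = x \<and> \<gamma> (dist x y) = y \<and>
     (\<forall>s\<in>{0..dist x y}. \<forall>t\<in>{0..dist x y}. dist (\<gamma> s) (\<gamma> t) = \<bar>s - t\<bar>)"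

class busemann_space = metric_space +
  assumes geodesic: "\<exists>\<gamma>. natural_geodesic x y \<gamma>"
    and busemann_convex:
      "\<lbrakk>a \<le> b; a' \<le> b'; affine_geodesic_on a b \<gamma>; affine_geodesic_on a' b' \<gamma>'\<rbrakk>
        \<Longrightarrow> convex_on ({a..b} \<times> {a'..b'}) (\<lambda>(t, t'). dist (\<gamma> t) (\<gamma>' t'))"

section \<open>Rays and the geodesic boundary\<close>

definition is_ray :: "(real \<Rightarrow> 'a::metric_space) \<Rightarrow> bool" where
  "is_ray c \<longleftrightarrow> (\<forall>s\<ge>0. \<forall>t\<ge>0. dist (c s) (c t) = \<bar>s - t\<bar>)"

definition hausdorff_distance :: "'a::metric_space set \<Rightarrow> 'a set \<Rightarrow> ereal" where
  "hausdorff_distance A B =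
     max (SUP x\<in>A. ereal (infdist x B)) (SUP y\<in>B. ereal (infdist y A))"

definition asymptotic :: "((real \<Rightarrow> 'a::metric_space) \<times> (real \<Rightarrow> 'a)) set" where
  "asymptotic = {(c, d). is_ray c \<and> is_ray d \<and> hausdorff_distance (c ` {0..}) (d ` {0..}) < \<infinity>}"

definition gboundary :: "(real \<Rightarrow> 'a::metric_space) set set" where
  "gboundary = Collect is_ray // asymptotic"

definition ray_end :: "(real \<Rightarrow> 'a::metric_space) \<Rightarrow> (real \<Rightarrow> 'a) set" where
  "ray_end c = asymptotic `` {c}"

text \<open>In a proper Busemann space, the values on \<open>{0..}\<close> do not depend on the choice.\<close>

definition ray_from :: "'a::metric_space \<Rightarrow> (real \<Rightarrow> 'a) set \<Rightarrow> real \<Rightarrow> 'a" where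
  "ray_from x \<xi> = (SOME c. is_ray c \<and> c 0 = x \<and> ray_end c = \<xi>)"

section \<open>The geodesic compactification\<close>

text \<open>\<open>Inl\<close> marks the points of the space, \<open>Inr\<close> the ideal points.\<close>

type_synonym 'a gpoint = "'a + (real \<Rightarrow> 'a) set"

definition gcompact :: "'a::metric_space gpoint set" where
  "gcompact = UNIV <+> gboundary"

fun gdist :: "'a::metric_space \<Rightarrow> 'a gpoint \<Rightarrow> ereal" where
  "gdist p (Inl x) = ereal (dist p x)"
| "gdist p (Inr \<xi>) = \<infinity>"

text \<open>The segment or ray \<open>[pz]\<close> in natural parameterization; a segment is continued
  constantly beyond its endpoint, so that all paths are defined on \<open>{0..}\<close> and can be compared.\<close>

fun gpath :: "'a::metric_space \<Rightarrow> 'a gpoint \<Rightarrow> real \<Rightarrow> 'a" where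
  "gpath p (Inl x) t = (SOME \<gamma>. natural_geodesic p x \<gamma>) (min t (dist p x))"
| "gpath p (Inr \<xi>) t = ray_from p \<xi> t"

definition cone_converges :: "'a::metric_space \<Rightarrow> (nat \<Rightarrow> 'a gpoint) \<Rightarrow> 'a gpoint \<Rightarrow> bool" where
  "cone_converges p z w \<longleftrightarrow>
     (\<lambda>i. gdist p (z i)) \<longlonglongrightarrow> gdist p w \<and>
     (\<forall>R\<ge>0. uniform_limit {0..R} (\<lambda>i. gpath p (z i)) (gpath p w) sequentially)"

text \<open>The topology determined by this convergence of sequences: a set is open iff every sequence
  converging to one of its points is eventually inside.\<close>

definition cone_open :: "'a::metric_space \<Rightarrow> 'a gpoint set \<Rightarrow> bool" where
  "cone_open p U \<longleftrightarrow> U \<subseteq> gcompact \<and>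
     (\<forall>z w. range z \<subseteq> gcompact \<longrightarrow> w \<in> U \<longrightarrow> cone_converges p z w \<longrightarrow>
        (\<forall>\<^sub>F i in sequentially. z i \<in> U))"

definition cone_topology :: "'a::metric_space \<Rightarrow> 'a gpoint topology" where
  "cone_topology p = topology (cone_open p)"

lemma istopology_cone_open: "istopology (cone_open p)"
proof -
  have "cone_open p (S \<inter> T)" if "cone_open p S" "cone_open p T" for S T
    using that unfolding cone_open_def by (auto intro: eventually_conj)
  moreover have "cone_open p (\<Union>\<K>)" if K: "\<forall>K\<in>\<K>. cone_open p K" for \<K>
    unfolding cone_open_def
  proof (intro conjI allI impI)
    show "\<Union>\<K> \<subseteq> gcompact"
      using K unfolding cone_open_def by blast
  next
    fix z w
    assume z: "range z \<subseteq> gcompact" and w: "w \<in> \<Union>\<K>" and conv: "cone_converges p z w"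
    from w obtain K where "K \<in> \<K>" "w \<in> K" by blast
    with K z conv have "\<forall>\<^sub>F i in sequentially. z i \<in> K"
      unfolding cone_open_def by blast
    then show "\<forall>\<^sub>F i in sequentially. z i \<in> \<Union>\<K>"
      by (rule eventually_mono) (use \<open>K \<in> \<K>\<close> in blast)
  qed
  ultimately show ?thesis
    unfolding istopology_def by blast
qed

lemma openin_cone_topology: "openin (cone_topology p) = cone_open p"
  by (simp add: cone_topology_def istopology_cone_open)

section \<open>The horofunction compactification\<close>

definition CX :: "('a::metric_space \<Rightarrow> real) set" where
  "CX = {f. continuous_on UNIV f}"

text \<open>Uniform convergence on bounded sets.\<close>

definition CX_open :: "('a::metric_space \<Rightarrow> real) set \<Rightarrow> bool" where
  "CX_open U \<longleftrightarrow> U \<subseteq> CX \<and>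
     (\<forall>f\<in>U. \<exists>B \<epsilon>. bounded B \<and> \<epsilon> > 0 \<and> {g \<in> CX. \<forall>x\<in>B. \<bar>g x - f x\<bar> < \<epsilon>} \<subseteq> U)"

definition CX_topology :: "('a::metric_space \<Rightarrow> real) topology" where
  "CX_topology = topology CX_open"

lemma istopology_CX_open: "istopology (CX_open :: ('a::metric_space \<Rightarrow> real) set \<Rightarrow> bool)"
proof -
  have "CX_open (S \<inter> T)" if S: "CX_open S" and T: "CX_open T" for S T :: "('a \<Rightarrow> real) set"
    unfolding CX_open_def
  proof (intro conjI ballI)
    show "S \<inter> T \<subseteq> CX"
      using S unfolding CX_open_def by blast
  next
    fix f assume f: "f \<in> S \<inter> T"
    obtain B1 e1 where 1: "bounded B1" "e1 > 0" "{g \<in> CX. \<forall>x\<in>B1. \<bar>g x - f x\<bar> < e1} \<subseteq> S"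
      using S f unfolding CX_open_def by blast
    obtain B2 e2 where 2: "bounded B2" "e2 > 0" "{g \<in> CX. \<forall>x\<in>B2. \<bar>g x - f x\<bar> < e2} \<subseteq> T"
      using T f unfolding CX_open_def by blast
    have "{g \<in> CX. \<forall>x\<in>B1 \<union> B2. \<bar>g x - f x\<bar> < min e1 e2} \<subseteq> S \<inter> T"
      using 1(3) 2(3) by auto
    moreover have "bounded (B1 \<union> B2)" "min e1 e2 > 0"
      using 1 2 by auto
    ultimately show "\<exists>B \<epsilon>. bounded B \<and> \<epsilon> > 0 \<and> {g \<in> CX. \<forall>x\<in>B. \<bar>g x - f x\<bar> < \<epsilon>} \<subseteq> S \<inter> T"
      by blast
  qed
  moreover have "CX_open (\<Union>\<K>)" if K: "\<forall>K\<in>\<K>. CX_open K" for \<K> :: "('a \<Rightarrow> real) set set"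
    unfolding CX_open_def
  proof (intro conjI ballI)
    show "\<Union>\<K> \<subseteq> CX"
      using K unfolding CX_open_def by blast
  next
    fix f assume "f \<in> \<Union>\<K>"
    then obtain K where "K \<in> \<K>" "f \<in> K" by blast
    with K have "\<exists>B \<epsilon>. bounded B \<and> \<epsilon> > 0 \<and> {g \<in> CX. \<forall>x\<in>B. \<bar>g x - f x\<bar> < \<epsilon>} \<subseteq> K"
      unfolding CX_open_def by blast
    with \<open>K \<in> \<K>\<close>
    show "\<exists>B \<epsilon>. bounded B \<and> \<epsilon> > 0 \<and> {g \<in> CX. \<forall>x\<in>B. \<bar>g x - f x\<bar> < \<epsilon>} \<subseteq> \<Union>\<K>"
      by (meson Union_upper order_trans)
  qed
  ultimately show ?thesis
    unfolding istopology_def by blast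
qed

lemma openin_CX_topology: "openin CX_topology = CX_open"
  by (simp add: CX_topology_def istopology_CX_open)

definition const_rel :: "(('a::metric_space \<Rightarrow> real) \<times> ('a \<Rightarrow> real)) set" where
  "const_rel = {(f, g). f \<in> CX \<and> g \<in> CX \<and> (\<exists>k. \<forall>x. g x = f x + k)}"

definition fclass :: "('a::metric_space \<Rightarrow> real) \<Rightarrow> ('a \<Rightarrow> real) set" where
  "fclass f = const_rel `` {f}"

definition Cstar :: "('a::metric_space \<Rightarrow> real) set set" where
  "Cstar = CX // const_rel"

text \<open>The quotient topology.\<close>

definition Cstar_open :: "('a::metric_space \<Rightarrow> real) set set \<Rightarrow> bool" where
  "Cstar_open U \<longleftrightarrow> U \<subseteq> Cstar \<and> openin CX_topology {f \<in> CX. fclass f \<in> U}"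

definition Cstar_topology :: "('a::metric_space \<Rightarrow> real) set topology" where
  "Cstar_topology = topology Cstar_open"

lemma istopology_Cstar_open: "istopology (Cstar_open :: ('a::metric_space \<Rightarrow> real) set set \<Rightarrow> bool)"
proof -
  have "Cstar_open (S \<inter> T)" if "Cstar_open S" "Cstar_open T" for S T :: "('a \<Rightarrow> real) set set"
  proof -
    have "{f \<in> CX. fclass f \<in> S \<inter> T} = {f \<in> CX. fclass f \<in> S} \<inter> {f \<in> CX. fclass f \<in> T}"
      by blast
    with that show ?thesis
      unfolding Cstar_open_def by (auto intro: openin_Int)
  qed
  moreover have "Cstar_open (\<Union>\<K>)" if K: "\<forall>K\<in>\<K>. Cstar_open K"
    for \<K> :: "('a \<Rightarrow> real) set set set"
  proof -
    have "{f \<in> CX. fclass f \<in> \<Union>\<K>} = (\<Union>K\<in>\<K>. {f \<in> CX. fclass f \<in> K})"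
      by blast
    with K show ?thesis
      unfolding Cstar_open_def by (auto intro!: openin_Union)
  qed
  ultimately show ?thesis
    unfolding istopology_def by blast
qed

lemma openin_Cstar_topology: "openin Cstar_topology = Cstar_open"
  by (simp add: Cstar_topology_def istopology_Cstar_open)

definition hembed :: "'a::metric_space \<Rightarrow> ('a \<Rightarrow> real) set" where
  "hembed x = fclass (\<lambda>y. dist x y)"

definition hcompact :: "('a::metric_space \<Rightarrow> real) set set" where
  "hcompact = Cstar_topology closure_of (range hembed)"

definition hboundary :: "('a::metric_space \<Rightarrow> real) set set" where
  "hboundary = hcompact - range hembed"

definition horofunction :: "('a::metric_space \<Rightarrow> real) \<Rightarrow> bool" where
  "horofunction \<Phi> \<longleftrightarrow> \<Phi> \<in> CX \<and> fclass \<Phi> \<in> hboundary"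

text \<open>The continuous extension of the identity. It is unique on \<open>hcompact\<close>, because
  \<open>range hembed\<close> is dense there and the cone topology is Hausdorff; the values outside
  \<open>hcompact\<close> are irrelevant.\<close>

definition pi_hg :: "'a::metric_space \<Rightarrow> ('a \<Rightarrow> real) set \<Rightarrow> 'a gpoint" where
  "pi_hg p = (SOME F.
     continuous_map (subtopology Cstar_topology hcompact) (cone_topology p) F \<and>
     (\<forall>x. F (hembed x) = Inl x))"

section \<open>The relations Td\<close>

definition Td_le_half_pi :: "('a::metric_space \<Rightarrow> real) set \<Rightarrow> (real \<Rightarrow> 'a) set \<Rightarrow> bool" where
  "Td_le_half_pi P \<xi> \<longleftrightarrow>
     (\<exists>\<Phi>\<in>P. \<exists>c. is_ray c \<and> ray_end c = \<xi> \<and> antimono_on {0..} (\<Phi> \<circ> c))"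

definition delta :: "'a::metric_space \<Rightarrow> (real \<Rightarrow> 'a) set \<Rightarrow> (real \<Rightarrow> 'a) set \<Rightarrow> real" where
  "delta p \<xi> \<eta> = Lim at_top (\<lambda>t. dist (ray_from p \<xi> t) (ray_from p \<eta> t) / (2 * t))"

definition Td_less_pi :: "'a::metric_space \<Rightarrow> (real \<Rightarrow> 'a) set \<Rightarrow> (real \<Rightarrow> 'a) set \<Rightarrow> bool" where
  "Td_less_pi p \<xi> \<eta> \<longleftrightarrow> delta p \<xi> \<eta> < 1"

definition Td_le_pi :: "'a::metric_space \<Rightarrow> (real \<Rightarrow> 'a) set \<Rightarrow> (real \<Rightarrow> 'a) set \<Rightarrow> bool" where
  "Td_le_pi p \<xi> \<eta> \<longleftrightarrow>
     (\<forall>U V. openin (cone_topology p) U \<longrightarrow> Inr \<xi> \<in> U \<longrightarrow>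
            openin (cone_topology p) V \<longrightarrow> Inr \<eta> \<in> V \<longrightarrow>
        (\<exists>\<xi>'\<in>gboundary. \<exists>\<eta>'\<in>gboundary. Inr \<xi>' \<in> U \<and> Inr \<eta>' \<in> V \<and> Td_less_pi p \<xi>' \<eta>'))"

end

theory Submission
  imports Defs "HOL-Library.Diagonal_Subsequence"
begin

text \<open>A horofunction \<open>f\<close> is convex and 1-Lipschitz, and balls of a Busemann space are strictly
  convex; hence from each point there is at most one direction in which \<open>f\<close> descends at the
  maximal rate 1. The ray from \<open>p\<close> to \<open>\<xi> = \<pi>\<^sub>h\<^sub>g[\<Phi>]\<close> is this path of steepest descent, and by
  convexity every other ray from \<open>p\<close> that leaves it loses a definite linear rate.

  Let \<open>c\<close> be a ray to \<open>\<zeta>\<close>; then \<open>\<Phi>\<close> and \<open>\<Psi>\<close> are bounded above on \<open>c\<close>. For a far point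
  \<open>z = c t\<close>, let \<open>x\<close> and \<open>y\<close> be the midpoints of \<open>z\<close> with points at distances \<open>r\<close> and \<open>r'\<close> on
  \<open>[p\<xi>]\<close> and \<open>[p\<eta>]\<close>. Convexity of the metric gives \<open>|xy| \<le> (r + r')/2\<close>, while convexity of \<open>\<Phi>\<close>
  gives \<open>\<Phi> x \<le> \<Phi> p - r/2 + O(1)\<close>. If \<open>r\<close> is chosen such that \<open>[px]\<close> deviates from \<open>[p\<xi>]\<close> by
  exactly 1 at distance \<open>K\<close> (or \<open>r = 0\<close>, if \<open>[pz]\<close> is already this close), the linear loss yields \<open>r/2 \<le> (1 - \<gamma>)|px| + O(1)\<close> with \<open>\<gamma> > 0\<close>
  independent of \<open>t\<close>, and likewise for \<open>y\<close>. So \<open>|xy| \<le> (1 - \<gamma>)(|px| + |py|) + O(1)\<close>, and limits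
  of \<open>[px]\<close> and \<open>[py]\<close> as \<open>t \<rightarrow> \<infinity>\<close> are rays close to \<open>\<xi>\<close> and \<open>\<eta>\<close> whose \<open>\<delta>\<close> is less than 1.\<close>

section \<open>Convexity in Busemann spaces\<close>

text \<open>The parameter runs over the unit interval for all endpoints, so that convexity compares
  segments of different lengths at equal parameters. The choice under \<open>SOME\<close> is the one
  made in \<open>gpath\<close>.\<close>

definition geo :: "'a::busemann_space \<Rightarrow> 'a \<Rightarrow> real \<Rightarrow> 'a" where
  "geo x y u = (SOME \<gamma>. natural_geodesic x y \<gamma>) (u * dist x y)"

lemma natural_geodesic_some:
  "natural_geodesic x y (SOME \<gamma>. natural_geodesic (x::'a::busemann_space) y \<gamma>)"
  by (rule someI_ex[of "natural_geodesic x y", OF geodesic])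

lemma geo_0 [simp]: "geo x y 0 = x" and geo_1 [simp]: "geo x y 1 = y"
  using natural_geodesic_some[of x y] by (simp_all add: geo_def natural_geodesic_def)

lemma dist_geo_geo:
  assumes "0 \<le> u" "u \<le> 1" "0 \<le> v" "v \<le> 1"
  shows "dist (geo x y u) (geo x y v) = \<bar>u - v\<bar> * dist x y"
proof -
  have "u * dist x y \<in> {0..dist x y}" "v * dist x y \<in> {0..dist x y}"
    using assms by (auto simp: mult_left_le_one_le)
  then have "dist (geo x y u) (geo x y v) = \<bar>u * dist x y - v * dist x y\<bar>"
    using natural_geodesic_some[of x y] unfolding geo_def natural_geodesic_def by blast
  then show ?thesis
    by (simp add: left_diff_distrib[symmetric] abs_mult)
qed

lemma affine_geodesic_on_geo: "affine_geodesic_on 0 1 (geo x y)"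
  unfolding affine_geodesic_on_def
  by (rule exI[of _ "dist x y"]) (auto simp: dist_geo_geo)

lemma busemann_diagonal:
  fixes \<gamma> \<gamma>' :: "real \<Rightarrow> 'a::busemann_space"
  assumes "affine_geodesic_on 0 1 \<gamma>" "affine_geodesic_on 0 1 \<gamma>'" "0 \<le> u" "u \<le> 1"
  shows "dist (\<gamma> u) (\<gamma>' u) \<le> (1 - u) * dist (\<gamma> 0) (\<gamma>' 0) + u * dist (\<gamma> 1) (\<gamma>' 1)"
proof -
  have "convex_on ({0..1} \<times> {0..1}) (\<lambda>(t, t'). dist (\<gamma> t) (\<gamma>' t'))"
    using assms by (intro busemann_convex) auto
  from convex_onD[OF this, of u "(0,0)" "(1,1)"] show ?thesis
    using assms by simp
qed

text \<open>The diagonal convexity bound vanishes when both pairs of endpoints agree. This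
  identifies subsegments, reversed segments and pieces of rays below.\<close>

lemma geo_unique:
  fixes \<gamma> :: "real \<Rightarrow> 'a::busemann_space"
  assumes "affine_geodesic_on 0 1 \<gamma>" "0 \<le> u" "u \<le> 1"
  shows "geo (\<gamma> 0) (\<gamma> 1) u = \<gamma> u"
  using busemann_diagonal[OF affine_geodesic_on_geo[of "\<gamma> 0" "\<gamma> 1"] assms] by simp

lemma dist_geo_le:
  assumes "0 \<le> u" "u \<le> 1"
  shows "dist (geo x y u) (geo x' y' u) \<le> (1 - u) * dist x x' + u * dist y y'"
  using busemann_diagonal[OF affine_geodesic_on_geo affine_geodesic_on_geo assms] by simp

lemma geo_same [simp]:
  assumes "0 \<le> u" "u \<le> 1"
  shows "geo x x u = x"
  using dist_geo_geo[of u 0 x x] assms by simp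

lemma dist_point_geo_le:
  assumes "0 \<le> u" "u \<le> 1"
  shows "dist q (geo x y u) \<le> (1 - u) * dist q x + u * dist q y"
  using dist_geo_le[OF assms, of q q x y] assms by simp

lemma geo_geo:
  assumes "0 \<le> u" "u \<le> 1" "0 \<le> v" "v \<le> 1"
  shows "geo x (geo x y v) u = geo x y (u * v)"
proof -
  have *: "0 \<le> s * v \<and> s * v \<le> 1" if "s \<in> {0..1}" for s
    using that assms by (auto intro: mult_le_one)
  have "affine_geodesic_on 0 1 (\<lambda>u. geo x y (u * v))"
    unfolding affine_geodesic_on_def
  proof (intro exI[of _ "v * dist x y"] conjI ballI)
    fix s t :: real assume "s \<in> {0..1}" "t \<in> {0..1}"
    then have "dist (geo x y (s * v)) (geo x y (t * v)) = \<bar>s * v - t * v\<bar> * dist x y"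
      using * by (intro dist_geo_geo) auto
    also have "\<dots> = v * dist x y * \<bar>s - t\<bar>"
      using assms by (simp add: left_diff_distrib[symmetric] abs_mult)
    finally show "dist (geo x y (s * v)) (geo x y (t * v)) = v * dist x y * \<bar>s - t\<bar>" .
  qed (use assms in auto)
  from geo_unique[OF this assms(1,2)] show ?thesis by simp
qed

lemma geo_reverse:
  assumes "0 \<le> u" "u \<le> 1"
  shows "geo y x u = geo x y (1 - u)"
proof -
  have "affine_geodesic_on 0 1 (\<lambda>u. geo x y (1 - u))"
    unfolding affine_geodesic_on_def
    by (rule exI[of _ "dist x y"]) (auto simp: dist_geo_geo)
  from geo_unique[OF this assms] show ?thesis by simp
qed

lemma ray_geo:
  fixes c :: "real \<Rightarrow> 'a::busemann_space"
  assumes "is_ray c" "0 \<le> u" "u \<le> 1" "0 \<le> s"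
  shows "geo (c 0) (c s) u = c (u * s)"
proof -
  have "affine_geodesic_on 0 1 (\<lambda>u. c (u * s))"
    unfolding affine_geodesic_on_def
    by (rule exI[of _ s])
      (use assms in \<open>auto simp: is_ray_def left_diff_distrib[symmetric] abs_mult\<close>)
  from geo_unique[OF this assms(2,3)] show ?thesis by simp
qed

section \<open>Strict convexity of balls\<close>

lemma midpoint_unique:
  fixes x y a :: "'a::busemann_space"
  assumes xa: "dist x a = dist x y / 2" and ay: "dist a y = dist x y / 2"
  shows "a = geo x y (1/2)"
proof -
  define D where "D = dist x y"
  \<comment> \<open>The segments from \<open>x\<close> to \<open>a\<close> and from \<open>a\<close>
    to \<open>y\<close> are concatenated. Their lengths add up to \<open>dist x y\<close>, so the
    triangle inequality leaves no slack: the concatenation is a geodesic and uniqueness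
    applies.\<close>
  define \<gamma> where "\<gamma> u = (if u \<le> 1/2 then geo x a (2 * u) else geo a y (2 * u - 1))" for u
  have lo: "dist (\<gamma> s) (\<gamma> t) = D * \<bar>s - t\<bar>" if "s \<in> {0..1/2}" "t \<in> {0..1/2}" for s t
    using that by (simp add: \<gamma>_def dist_geo_geo xa D_def abs_if)
  have hi: "dist (\<gamma> s) (\<gamma> t) = D * \<bar>s - t\<bar>" if "s \<in> {1/2<..1}" "t \<in> {1/2<..1}" for s t
    using that by (simp add: \<gamma>_def dist_geo_geo ay D_def abs_if)
  have [simp]: "\<gamma> 0 = x" "\<gamma> 1 = y" "\<gamma> (1/2) = a"
    by (auto simp: \<gamma>_def)
  have mid: "dist (\<gamma> s) (\<gamma> t) = D * (t - s)" if s: "s \<in> {0..1/2}" and t: "t \<in> {1/2<..1}" for s t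
  proof (rule antisym)
    have "dist (\<gamma> s) a = D * (1/2 - s)"
      using lo[of s "1/2"] s by simp
    moreover have "dist a (\<gamma> t) = D * (t - 1/2)"
      using t dist_geo_geo[of 0 "2 * t - 1" a y] by (simp add: \<gamma>_def ay D_def field_simps)
    ultimately show "dist (\<gamma> s) (\<gamma> t) \<le> D * (t - s)"
      using dist_triangle[of "\<gamma> s" "\<gamma> t" a] by (simp add: algebra_simps)
    have "dist x (\<gamma> s) = D * s" "dist (\<gamma> t) y = D * (1 - t)"
      using lo[of 0 s] hi[of t 1] s t by auto
    then show "D * (t - s) \<le> dist (\<gamma> s) (\<gamma> t)"
      using dist_triangle[of x y "\<gamma> s"] dist_triangle[of "\<gamma> s" y "\<gamma> t"]
      by (simp add: algebra_simps D_def)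
  qed
  have "affine_geodesic_on 0 1 \<gamma>"
    unfolding affine_geodesic_on_def
  proof (intro exI[of _ D] conjI ballI)
    fix s t :: real assume st: "s \<in> {0..1}" "t \<in> {0..1}"
    consider "s \<le> 1/2" "t \<le> 1/2" | "s > 1/2" "t > 1/2" | "s \<le> 1/2" "t > 1/2" | "s > 1/2" "t \<le> 1/2"
      by linarith
    then show "dist (\<gamma> s) (\<gamma> t) = D * \<bar>s - t\<bar>"
    proof cases
      case 3 then show ?thesis using mid[of s t] st by simp
    next
      case 4 then show ?thesis using mid[of t s] st by (simp add: dist_commute)
    qed (use lo hi st in auto)
  qed (simp add: D_def)
  from geo_unique[OF this, of "1/2"] show ?thesis by simp
qed

text \<open>Let \<open>m\<close> be the midpoint of \<open>w\<close> and \<open>w'\<close>.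
  Convexity puts the midpoint of \<open>q\<close> and \<open>w\<close> within \<open>s/2\<close> of
  \<open>m\<close>, so it is also the midpoint of \<open>q\<close> and \<open>m\<close>; the same
  holds for \<open>w'\<close>. The two midpoints coincide and serve as \<open>a\<close>, which
  reproduces the situation for the same \<open>w\<close>, \<open>w'\<close> at half the
  scale.\<close>

lemma strictly_convex_halving:
  fixes q w w' :: "'a::busemann_space"
  assumes "dist q w = s" "dist q w' = s" "dist q (geo w w' (1/2)) = s"
  shows "\<exists>a. dist a w = s/2 \<and> dist a w' = s/2 \<and> dist a (geo w w' (1/2)) = s/2"
proof -
  define m where "m = geo w w' (1/2)"
  have half: "geo q v (1/2) = geo q m (1/2) \<and> dist (geo q v (1/2)) v = s/2 \<and>
      dist (geo q v (1/2)) m = s/2"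
    if v: "v = w \<and> v' = w' \<or> v = w' \<and> v' = w" for v v'
  proof -
    let ?a = "geo q v (1/2)"
    have qv: "dist q v = s" "dist q v' = s" and qm: "dist q m = s"
      using v assms by (auto simp: m_def)
    have m: "m = geo v v' (1/2)"
      using v geo_reverse[of "1/2" w w'] by (auto simp: m_def)
    have "dist ?a m \<le> s/2"
      using dist_geo_le[of "1/2" v q v v'] geo_reverse[of "1/2" v q] qv by (simp add: m)
    moreover have 1: "dist q ?a = s/2" "dist ?a v = s/2"
      using dist_geo_geo[of 0 "1/2" q v] dist_geo_geo[of "1/2" 1 q v] qv by auto
    ultimately have 2: "dist ?a m = s/2"
      using dist_triangle[of q m ?a] qm by linarith
    have "?a = geo q m (1/2)"
      by (rule midpoint_unique) (simp_all add: 1 2 qm)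
    with 1 2 show ?thesis by simp
  qed
  from half[of w w'] half[of w' w] show ?thesis
    unfolding m_def by metis
qed

text \<open>If the midpoint were at distance \<open>s\<close>, repeated halving would give points at
  distance \<open>s/2^n\<close> from both \<open>w\<close> and \<open>w'\<close>, for every
  \<open>n\<close>.\<close>

lemma strictly_convex:
  fixes q w w' :: "'a::busemann_space"
  assumes "dist q w = s" "dist q w' = s" "w \<noteq> w'"
  shows "dist q (geo w w' (1/2)) < s"
proof (rule ccontr)
  assume "\<not> ?thesis"
  moreover have "dist q (geo w w' (1/2)) \<le> s"
    using dist_point_geo_le[of "1/2" q w w'] assms by simp
  ultimately have 0: "dist q (geo w w' (1/2)) = s" by simp
  have "\<exists>a. dist a w = s/2^n \<and> dist a w' = s/2^n \<and> dist a (geo w w' (1/2)) = s/2^n" for n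
  proof (induction n)
    case 0 show ?case using 0 assms \<open>dist q (geo w w' (1/2)) = s\<close> by (intro exI[of _ q]) simp
  next
    case (Suc n)
    then obtain a where "dist a w = s/2^n" "dist a w' = s/2^n" "dist a (geo w w' (1/2)) = s/2^n"
      by blast
    from strictly_convex_halving[OF this] show ?case by (simp add: mult.commute)
  qed
  then have le: "dist w w' \<le> 2 * (s / 2^n)" for n
    by (metis dist_triangle3 mult_2)
  have "(\<lambda>n. 2 * (s * (1/2)^n)) \<longlonglongrightarrow> 2 * (s * 0)"
    by (intro tendsto_intros LIMSEQ_power_zero) auto
  then have "dist w w' \<le> 2 * (s * 0)"
    by (rule LIMSEQ_le_const) (use le in \<open>auto simp: field_simps\<close>)
  with assms show False by simp
qed

section \<open>Convex 1-Lipschitz functions and steepest descent\<close>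

definition convex_lipschitz :: "('a::busemann_space \<Rightarrow> real) \<Rightarrow> bool" where
  "convex_lipschitz f \<longleftrightarrow> (\<forall>x y. \<bar>f x - f y\<bar> \<le> dist x y) \<and>
     (\<forall>x y u. 0 \<le> u \<longrightarrow> u \<le> 1 \<longrightarrow> f (geo x y u) \<le> (1 - u) * f x + u * f y)"

lemma convex_lipschitzD:
  assumes "convex_lipschitz f"
  shows "\<bar>f x - f y\<bar> \<le> dist x y"
    and "0 \<le> u \<Longrightarrow> u \<le> 1 \<Longrightarrow> f (geo x y u) \<le> (1 - u) * f x + u * f y"
  using assms by (auto simp: convex_lipschitz_def)

lemma convex_lipschitz_dist: "convex_lipschitz (\<lambda>y. dist x y + k)"
  unfolding convex_lipschitz_def
proof (intro conjI allI impI)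
  fix y z and u :: real assume "0 \<le> u" "u \<le> 1"
  then show "dist x (geo y z u) + k \<le> (1 - u) * (dist x y + k) + u * (dist x z + k)"
    using dist_point_geo_le[of u x y z] by (simp add: algebra_simps)
next
  fix y z show "\<bar>dist x y + k - (dist x z + k)\<bar> \<le> dist y z"
    using dist_triangle[of x y z] dist_triangle[of x z y] by (auto simp: dist_commute)
qed

text \<open>Both conditions are closed under pointwise limits; this is how horofunctions inherit
  them from distance functions.\<close>

lemma convex_lipschitz_limit:
  fixes f :: "'a::busemann_space \<Rightarrow> real"
  assumes g: "\<And>n. convex_lipschitz (g n)" and lim: "\<And>x. (\<lambda>n. g n x) \<longlonglongrightarrow> f x"
  shows "convex_lipschitz f"
  unfolding convex_lipschitz_def
proof (intro conjI allI impI)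
  fix x y
  have "(\<lambda>n. \<bar>g n x - g n y\<bar>) \<longlonglongrightarrow> \<bar>f x - f y\<bar>"
    by (intro tendsto_intros lim)
  then show "\<bar>f x - f y\<bar> \<le> dist x y"
    by (rule LIMSEQ_le_const2) (use convex_lipschitzD(1)[OF g] in auto)
next
  fix x y and u :: real assume u: "0 \<le> u" "u \<le> 1"
  have "(\<lambda>n. (1 - u) * g n x + u * g n y) \<longlonglongrightarrow> (1 - u) * f x + u * f y"
    by (intro tendsto_intros lim)
  with lim[of "geo x y u"] show "f (geo x y u) \<le> (1 - u) * f x + u * f y"
    by (rule LIMSEQ_le) (use convex_lipschitzD(2)[OF g u] in auto)
qed

lemma convex_lipschitz_continuous:
  assumes "convex_lipschitz f"
  shows "continuous_on S f"
proof (rule continuous_onI)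
  fix x and e :: real assume "e > 0"
  moreover have "dist (f y) (f x) \<le> dist y x" for y
    using convex_lipschitzD(1)[OF assms] by (simp add: dist_real_def)
  ultimately show "\<exists>d>0. \<forall>y\<in>S. dist y x < d \<longrightarrow> dist (f y) (f x) \<le> e"
    by (intro exI[of _ e]) (meson less_eq_real_def order_trans)
qed

lemma steepest_descent_dist:
  assumes "convex_lipschitz f" "dist q w \<le> s" "f w = f q - s"
  shows "dist q w = s"
  using convex_lipschitzD(1)[OF assms(1), of q w] assms(2,3) by linarith

text \<open>Two different points of this kind would have a midpoint that descends as much but is
  strictly closer to \<open>q\<close>.\<close>

lemma steepest_descent_unique:
  assumes f: "convex_lipschitz f"
    and w: "dist q w \<le> s" "f w = f q - s" and w': "dist q w' \<le> s" "f w' = f q - s"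
  shows "w = w'"
proof (rule ccontr)
  assume "w \<noteq> w'"
  with steepest_descent_dist[OF f w] steepest_descent_dist[OF f w']
  have "dist q (geo w w' (1/2)) < s"
    by (intro strictly_convex)
  moreover have "f (geo w w' (1/2)) \<le> f q - s"
    using convex_lipschitzD(2)[OF f, of "1/2" w w'] w w' by simp
  ultimately show False
    using convex_lipschitzD(1)[OF f, of q "geo w w' (1/2)"] by linarith
qed

section \<open>The points of the segments from the base point\<close>

lemma gpath_Inl:
  fixes q :: "'a::busemann_space"
  assumes "0 \<le> s"
  shows "gpath q (Inl w) s = geo q w (min s (dist q w) / dist q w)"
  using assms by (cases "dist q w = 0") (auto simp: geo_def)

lemma gpath_Inl_min: "gpath q (Inl w) (min s (dist q w)) = gpath q (Inl w) s"
  by simp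

declare gpath.simps(1) [simp del]

lemma gpath_Inl_geo:
  fixes q :: "'a::busemann_space"
  assumes "0 \<le> s" "s \<le> dist q w"
  shows "gpath q (Inl w) s = geo q w (s / dist q w)"
  using assms by (simp add: gpath_Inl)

lemma gpath_Inl_end [simp]:
  fixes q :: "'a::busemann_space"
  shows "gpath q (Inl w) (dist q w) = w"
  by (cases "w = q") (simp_all add: gpath_Inl_geo)

lemma dist_gpath_Inl:
  fixes q :: "'a::busemann_space"
  assumes "0 \<le> s" "s \<le> dist q w" "0 \<le> t" "t \<le> dist q w"
  shows "dist (gpath q (Inl w) s) (gpath q (Inl w) t) = \<bar>s - t\<bar>"
proof (cases "w = q")
  case False
  with assms have "dist (gpath q (Inl w) s) (gpath q (Inl w) t) = \<bar>s / dist q w - t / dist q w\<bar> * dist q w"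
    by (simp only: gpath_Inl_geo) (rule dist_geo_geo; simp)
  also have "\<dots> = \<bar>s - t\<bar>"
    using False by (simp add: diff_divide_distrib[symmetric])
  finally show ?thesis .
qed (use assms in auto)

lemma dist_base_gpath_Inl:
  fixes q :: "'a::busemann_space"
  assumes "0 \<le> s"
  shows "dist q (gpath q (Inl w) s) = min s (dist q w)"
proof -
  have "gpath q (Inl w) s = gpath q (Inl w) (min s (dist q w))"
    by (simp add: gpath_Inl_min)
  moreover have "gpath q (Inl w) 0 = q"
    by (simp add: gpath_Inl)
  ultimately show ?thesis
    using dist_gpath_Inl[of 0 q w "min s (dist q w)"] assms by (metis abs_minus_commute
      abs_of_nonneg diff_zero min.bounded_iff min.cobounded2 order.refl zero_le_dist)
qed

lemma dist_gpath_Inl_end: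
  fixes q :: "'a::busemann_space"
  assumes "0 \<le> s"
  shows "dist (gpath q (Inl w) s) w = dist q w - min s (dist q w)"
  using dist_gpath_Inl[of "min s (dist q w)" q w "dist q w"] gpath_Inl_min[of q w s] assms
  by simp

lemma gpath_gpath_Inl:
  fixes q :: "'a::busemann_space"
  assumes "0 \<le> s" "s \<le> r" "r \<le> dist q w"
  shows "gpath q (Inl (gpath q (Inl w) r)) s = gpath q (Inl w) s"
proof (cases "r = 0 \<or> w = q")
  case False
  then have pos: "r > 0" "dist q w > 0"
    using assms by auto
  have d: "dist q (gpath q (Inl w) r) = r"
    using assms by (subst dist_base_gpath_Inl) auto
  have "gpath q (Inl (gpath q (Inl w) r)) s = geo q (geo q w (r / dist q w)) (s / r)"
    using assms d by (metis gpath_Inl_geo order_trans)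
  also have "\<dots> = geo q w (s / r * (r / dist q w))"
    using assms pos by (intro geo_geo) auto
  also have "\<dots> = gpath q (Inl w) s"
    using assms pos by (simp add: gpath_Inl_geo)
  finally show ?thesis .
next
  case True
  then show ?thesis
    using assms by (auto simp: gpath_Inl)
qed

text \<open>Both segments start at \<open>q\<close>, so one term of the convexity bound vanishes and
  the deviation divided by time is nondecreasing. Estimates far out are carried back to a fixed time
  in this way.\<close>

lemma dist_gpath_shrink:
  fixes q :: "'a::busemann_space"
  assumes "0 \<le> s" "s \<le> r" "0 < r" "r \<le> dist q w" "r \<le> dist q w'"
  shows "dist (gpath q (Inl w) s) (gpath q (Inl w') s)
    \<le> s / r * dist (gpath q (Inl w) r) (gpath q (Inl w') r)"
proof -
  have *: "gpath q (Inl v) s = geo q (gpath q (Inl v) r) (s / r)" if "r \<le> dist q v" for v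
  proof -
    have "dist q (gpath q (Inl v) r) = r"
      using assms that by (subst dist_base_gpath_Inl) auto
    then show ?thesis
      using gpath_gpath_Inl[of s r q v] gpath_Inl_geo[of s q "gpath q (Inl v) r"] assms that
      by metis
  qed
  show ?thesis
    unfolding *[OF assms(4)] *[OF assms(5)]
    using dist_geo_le[of "s/r" q "gpath q (Inl w) r" q "gpath q (Inl w') r"] assms by simp
qed

text \<open>The longer segment is cut at the length of the shorter one. The piece cut off is at most
  \<open>dist w w'\<close> long, which accounts for the factor 2; towards \<open>q\<close> the
  segments only get closer.\<close>

lemma dist_gpath_Inl_le:
  fixes q :: "'a::busemann_space"
  assumes "0 \<le> s" "s \<le> dist q w" "s \<le> dist q w'"
  shows "dist (gpath q (Inl w) s) (gpath q (Inl w') s) \<le> 2 * dist w w'"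
  using assms
proof (induction "dist q w" "dist q w'" arbitrary: w w' rule: linorder_wlog)
  case le
  define v where "v = gpath q (Inl w') (dist q w)"
  show ?case
  proof (cases "w = q")
    case True
    then show ?thesis using le by (simp add: gpath_Inl)
  next
    case False
    have "dist (gpath q (Inl w) s) (gpath q (Inl w') s) \<le> s / dist q w * dist w v"
      using dist_gpath_shrink[of s "dist q w" q w w'] le False
      by (simp add: v_def)
    also have "\<dots> \<le> 1 * dist w v"
      by (intro mult_right_mono) (use le False in auto)
    also have "dist w v \<le> dist w w' + dist w' v"
      by (rule dist_triangle)
    also have "dist w' v = dist q w' - dist q w"
      using dist_gpath_Inl_end[of "dist q w" q w'] le by (simp add: v_def dist_commute)
    also have "\<dots> \<le> dist w w'"
      using dist_triangle[of q w' w] by simp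
    finally show ?thesis by simp
  qed
next
  case sym
  then show ?case by (simp add: dist_commute)
qed

lemma ray_gpath:
  fixes c :: "real \<Rightarrow> 'a::busemann_space"
  assumes "is_ray c" "0 \<le> s" "s \<le> r"
  shows "gpath (c 0) (Inl (c r)) s = c s"
proof -
  have d: "dist (c 0) (c r) = r"
    using assms by (simp add: is_ray_def)
  have "gpath (c 0) (Inl (c r)) s = geo (c 0) (c r) (s / r)"
    using gpath_Inl_geo[of s "c 0" "c r"] assms d by simp
  also have "\<dots> = c s"
    using ray_geo[OF assms(1), of "s / r" r] assms by (cases "r = 0") auto
  finally show ?thesis .
qed

lemma dist_rays_shrink:
  fixes c d :: "real \<Rightarrow> 'a::busemann_space"
  assumes "is_ray c" "is_ray d" "c 0 = d 0" "0 \<le> s" "s \<le> r" "0 < r"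
  shows "dist (c s) (d s) \<le> s / r * dist (c r) (d r)"
proof -
  have "r = dist (c 0) (c r)" "r = dist (c 0) (d r)"
    using assms by (auto simp: is_ray_def)
  with dist_gpath_shrink[of s r "c 0" "c r" "d r"] show ?thesis
    using ray_gpath[of c s r] ray_gpath[of c r r] ray_gpath[of d s r] ray_gpath[of d r r] assms
    by (simp)
qed

section \<open>Asymptotic rays\<close>

lemma is_rayD:
  "is_ray c \<Longrightarrow> 0 \<le> s \<Longrightarrow> 0 \<le> t \<Longrightarrow> dist (c s) (c t) = \<bar>s - t\<bar>"
  by (simp add: is_ray_def)

lemma hausdorff_distance_self: "hausdorff_distance A A < \<infinity>"
proof (cases "A = {}")
  case False
  then have "hausdorff_distance A A = 0"
    by (simp add: hausdorff_distance_def zero_ereal_def[symmetric])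
  then show ?thesis by simp
qed (simp add: hausdorff_distance_def bot_ereal_def)

lemma asymptotic_bounded:
  assumes "(c, d) \<in> asymptotic"
  obtains D where "\<And>t. 0 \<le> t \<Longrightarrow> \<exists>s\<ge>0. dist (c t) (d s) \<le> D"
proof -
  define h where "h = hausdorff_distance (c ` {0..}) (d ` {0..})"
  have "h < \<infinity>"
    using assms by (simp add: asymptotic_def h_def)
  have le: "ereal (infdist (c t) (d ` {0..})) \<le> h" if "0 \<le> t" for t
  proof -
    have "ereal (infdist (c t) (d ` {0..})) \<le> (SUP x\<in>c ` {0..}. ereal (infdist x (d ` {0..})))"
      using that by (intro SUP_upper) auto
    then show ?thesis
      by (simp add: h_def hausdorff_distance_def le_max_iff_disj)
  qed
  have "h \<noteq> -\<infinity>"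
    using le[of 0] by auto
  with \<open>h < \<infinity>\<close> obtain r where r: "h = ereal r"
    by (cases h) auto
  \<comment> \<open>The infimum in \<open>infdist\<close> need not be attained, hence the extra
    1.\<close>
  have "\<exists>s\<ge>0. dist (c t) (d s) \<le> r + 1" if "0 \<le> t" for t
  proof (rule ccontr)
    assume "\<not> ?thesis"
    then have "r + 1 \<le> dist (c t) x" if "x \<in> d ` {0..}" for x
      using that by force
    then have "r + 1 \<le> infdist (c t) (d ` {0..})"
      by (auto simp: infdist_def intro!: cINF_greatest)
    with le[OF that] r show False by simp
  qed
  with that show ?thesis by blast
qed

lemma ray_end_eqD:
  assumes "is_ray c" "is_ray d" "ray_end c = ray_end d"
  shows "(c, d) \<in> asymptotic"
proof -
  have "d \<in> ray_end d"
    using assms(2) hausdorff_distance_self by (simp add: ray_end_def asymptotic_def)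
  with assms(3) show ?thesis
    unfolding ray_end_def by blast
qed

text \<open>The deviation at equal times is bounded, and \<open>dist_rays_shrink\<close> bounds the
  deviation at \<open>s\<close> by \<open>s / n\<close> times that at \<open>n\<close>; then
  \<open>n\<close> tends to infinity.\<close>

lemma asymptotic_unique:
  fixes c d :: "real \<Rightarrow> 'a::busemann_space"
  assumes cd: "(c, d) \<in> asymptotic" and "c 0 = d 0" "0 \<le> s"
  shows "c s = d s"
proof -
  have rays: "is_ray c" "is_ray d"
    using cd by (auto simp: asymptotic_def)
  obtain D where D: "\<And>t. 0 \<le> t \<Longrightarrow> \<exists>s\<ge>0. dist (c t) (d s) \<le> D"
    using asymptotic_bounded[OF cd] by blast
  \<comment> \<open>The rays have a common start, so \<open>t\<close> and \<open>u\<close> are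
    distances from it and differ by at most \<open>D\<close>; moving from \<open>d u\<close> to
    \<open>d t\<close> costs this second \<open>D\<close>.\<close>
  have bound: "dist (c t) (d t) \<le> 2 * D" if "0 \<le> t" for t
  proof -
    obtain u where u: "0 \<le> u" "dist (c t) (d u) \<le> D"
      using D[OF \<open>0 \<le> t\<close>] by blast
    have "dist (d 0) (c t) = t"
      using is_rayD[OF rays(1), of 0 t] that \<open>c 0 = d 0\<close> by simp
    moreover have "dist (d 0) (d u) = u"
      using is_rayD[OF rays(2), of 0 u] u by simp
    moreover have "dist (d u) (d t) = \<bar>u - t\<bar>"
      using is_rayD[OF rays(2), of u t] that u by simp
    ultimately have "dist (d u) (d t) \<le> D"
      using u(2) dist_triangle[of "d 0" "d u" "c t"] dist_triangle[of "d 0" "c t" "d u"]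
        dist_commute[of "c t" "d u"] by linarith
    with u show ?thesis
      using dist_triangle[of "c t" "d t" "d u"] by linarith
  qed
  have "dist (c s) (d s) \<le> s * (2 * D) * inverse (real (Suc n))" if "s \<le> real (Suc n)" for n
  proof -
    have "dist (c s) (d s) \<le> s / real (Suc n) * dist (c (real (Suc n))) (d (real (Suc n)))"
      using rays assms that by (intro dist_rays_shrink) auto
    also have "\<dots> \<le> s / real (Suc n) * (2 * D)"
      using assms by (intro mult_left_mono bound) auto
    finally show ?thesis by (simp add: field_simps)
  qed
  moreover have "\<forall>\<^sub>F n in sequentially. s \<le> real (Suc n)"
    using eventually_ge_at_top[of "nat \<lceil>s\<rceil>"] by eventually_elim linarith
  ultimately have "\<forall>\<^sub>F n in sequentially. dist (c s) (d s) \<le> s * (2 * D) * inverse (real (Suc n))"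
    by (auto elim: eventually_mono)
  moreover have "(\<lambda>n. s * (2 * D) * inverse (real (Suc n))) \<longlonglongrightarrow> s * (2 * D) * 0"
    by (intro tendsto_intros LIMSEQ_inverse_real_of_nat)
  ultimately have "dist (c s) (d s) \<le> s * (2 * D) * 0"
    by (metis tendsto_lowerbound trivial_limit_sequentially)
  then show ?thesis by simp
qed

lemma ray_end_gboundary: "is_ray c \<Longrightarrow> ray_end c \<in> gboundary"
  by (simp add: gboundary_def ray_end_def quotientI)

text \<open>The ray \<open>c\<close> itself satisfies the condition in \<open>ray_from\<close>, and
  any other choice agrees with it at nonnegative times by \<open>asymptotic_unique\<close>.\<close>

lemma ray_from_ray_end:
  fixes c :: "real \<Rightarrow> 'a::busemann_space"
  assumes "is_ray c" "0 \<le> s"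
  shows "ray_from (c 0) (ray_end c) s = c s"
proof -
  let ?d = "ray_from (c 0) (ray_end c)"
  have "is_ray ?d \<and> ?d 0 = c 0 \<and> ray_end ?d = ray_end c"
    unfolding ray_from_def by (rule someI[of _ c]) (use assms in auto)
  then show ?thesis
    using asymptotic_unique[of ?d c s] ray_end_eqD[of ?d c] assms by simp
qed

section \<open>Neighbourhoods in the horofunction compactification\<close>

lemma fclass_iff: "g \<in> fclass f \<longleftrightarrow> f \<in> CX \<and> g \<in> CX \<and> (\<exists>k. \<forall>x. g x = f x + k)"
  by (auto simp: fclass_def const_rel_def)

lemma fclass_self: "f \<in> CX \<Longrightarrow> f \<in> fclass f"
  by (auto simp: fclass_iff intro: exI[of _ 0])

lemma CX_add: "f \<in> CX \<Longrightarrow> (\<lambda>x. f x + k) \<in> CX"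
  by (auto simp: CX_def intro!: continuous_intros)

lemma CX_dist: "(\<lambda>y. dist x y) \<in> CX"
  by (auto simp: CX_def intro!: continuous_intros)

lemma fclass_add:
  assumes "f \<in> CX"
  shows "fclass (\<lambda>x. f x + k) = fclass f"
proof -
  have "(\<exists>k'. \<forall>x. g x = f x + k + k') \<longleftrightarrow> (\<exists>k'. \<forall>x. g x = f x + k')" for g
  proof
    assume "\<exists>k'. \<forall>x. g x = f x + k + k'"
    then obtain k' where "\<forall>x. g x = f x + k + k'" ..
    then show "\<exists>k'. \<forall>x. g x = f x + k'"
      by (intro exI[of _ "k + k'"]) simp
  next
    assume "\<exists>k'. \<forall>x. g x = f x + k'"
    then obtain k' where "\<forall>x. g x = f x + k'" ..
    then show "\<exists>k'. \<forall>x. g x = f x + k + k'"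
      by (intro exI[of _ "k' - k"]) simp
  qed
  then show ?thesis
    using CX_add[OF assms, of k] assms by (auto simp: set_eq_iff fclass_iff)
qed

lemma hembed_inj: "hembed x = hembed y \<Longrightarrow> x = y"
proof -
  assume "hembed x = hembed y"
  then have "(\<lambda>z. dist y z) \<in> fclass (\<lambda>z. dist x z)"
    using fclass_self[OF CX_dist] by (simp add: hembed_def)
  then obtain k where k: "\<And>z. dist y z = dist x z + k"
    by (auto simp: fclass_iff)
  from k[of x] k[of y] show "x = y"
    by (simp add: dist_commute)
qed

text \<open>The bound \<open>\<eta> < e\<close> keeps this set open on a ball that need not be compact.\<close>

definition Cstar_nbhd :: "'a \<Rightarrow> ('a::metric_space \<Rightarrow> real) \<Rightarrow> real \<Rightarrow> real \<Rightarrow> ('a \<Rightarrow> real) set set" where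
  "Cstar_nbhd q f R e = fclass ` {g \<in> CX. \<exists>\<eta><e. \<forall>x\<in>cball q R. \<bar>g x - f x\<bar> \<le> \<eta>}"

lemma openin_Cstar_nbhd: "openin Cstar_topology (Cstar_nbhd q f R e)"
  unfolding openin_Cstar_topology Cstar_open_def
proof (intro conjI)
  show "Cstar_nbhd q f R e \<subseteq> Cstar"
    by (auto simp: Cstar_nbhd_def Cstar_def fclass_def intro: quotientI)
  show "openin CX_topology {g \<in> CX. fclass g \<in> Cstar_nbhd q f R e}"
    unfolding openin_CX_topology CX_open_def
  proof (intro conjI ballI)
    fix g assume "g \<in> {g \<in> CX. fclass g \<in> Cstar_nbhd q f R e}"
    then obtain h \<eta> where h: "g \<in> CX" "h \<in> CX" "fclass g = fclass h" "\<eta> < e"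
        "\<And>x. x \<in> cball q R \<Longrightarrow> \<bar>h x - f x\<bar> \<le> \<eta>"
      by (auto simp: Cstar_nbhd_def)
    have "h \<in> fclass g"
      using fclass_self[OF h(2)] h(3) by simp
    then obtain k where k: "\<And>x. h x = g x + k"
      unfolding fclass_iff by blast
    \<comment> \<open>Half of the room between \<eta> and \<open>e\<close>: a function
      \<epsilon>-close to \<open>g\<close> becomes admissible after the same constant
      \<open>k\<close> is added.\<close>
    define \<epsilon> where "\<epsilon> = (e - \<eta>) / 2"
    have "g' \<in> CX \<and> fclass g' \<in> Cstar_nbhd q f R e"
      if g': "g' \<in> CX" "\<And>x. x \<in> cball q R \<Longrightarrow> \<bar>g' x - g x\<bar> < \<epsilon>" for g'
    proof -
      have "\<bar>g' x + k - f x\<bar> \<le> \<eta> + \<epsilon>" if "x \<in> cball q R" for x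
        using g'(2)[OF that] h(5)[OF that] k[of x] by linarith
      moreover have "\<eta> + \<epsilon> < e"
        using h(4) by (simp add: \<epsilon>_def field_simps)
      ultimately have "fclass (\<lambda>x. g' x + k) \<in> Cstar_nbhd q f R e"
        using CX_add[OF g'(1)] unfolding Cstar_nbhd_def by blast
      with g'(1) show ?thesis by (simp add: fclass_add)
    qed
    moreover have "\<epsilon> > 0"
      using h(4) by (simp add: \<epsilon>_def)
    ultimately show "\<exists>B \<epsilon>. bounded B \<and> \<epsilon> > 0 \<and> {g' \<in> CX. \<forall>x\<in>B. \<bar>g' x - g x\<bar> < \<epsilon>}
        \<subseteq> {g \<in> CX. fclass g \<in> Cstar_nbhd q f R e}"
      by (intro exI[of _ "cball q R"] exI[of _ \<epsilon>]) auto
  qed auto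
qed

lemma fclass_in_Cstar_nbhd: "f \<in> CX \<Longrightarrow> e > 0 \<Longrightarrow> fclass f \<in> Cstar_nbhd q f R e"
  by (auto simp: Cstar_nbhd_def intro!: imageI exI[of _ 0])

lemma Cstar_nbhdD:
  assumes "P \<in> Cstar_nbhd q f R e"
  obtains g where "g \<in> CX" "P = fclass g" "\<And>x. x \<in> cball q R \<Longrightarrow> \<bar>g x - f x\<bar> < e"
  using assms by (force simp: Cstar_nbhd_def)

text \<open>Growing radii and vanishing tolerances make the representatives converge uniformly on
  every ball. These countably many neighbourhoods allow closure and continuity to be treated with
  sequences.\<close>

lemma Cstar_nbhd_seq:
  assumes "\<And>n. P n \<in> Cstar_nbhd q f (real n) (inverse (real (Suc n)))"
  obtains g where "\<And>n. g n \<in> CX" "\<And>n. P n = fclass (g n)"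
    "\<And>R. uniform_limit (cball q R) g f sequentially"
proof -
  have "\<exists>g. g \<in> CX \<and> P n = fclass g \<and>
      (\<forall>x\<in>cball q (real n). \<bar>g x - f x\<bar> < inverse (real (Suc n)))" for n
    using Cstar_nbhdD[OF assms[of n]] by metis
  then obtain g where g: "\<And>n. g n \<in> CX" "\<And>n. P n = fclass (g n)"
      "\<And>n x. x \<in> cball q (real n) \<Longrightarrow> \<bar>g n x - f x\<bar> < inverse (real (Suc n))"
    by metis
  have "uniform_limit (cball q R) g f sequentially" for R
    unfolding uniform_limit_iff
  proof (intro allI impI)
    fix e :: real assume "e > 0"
    then have "\<forall>\<^sub>F n in sequentially. inverse (real (Suc n)) < e"
      using LIMSEQ_inverse_real_of_nat by (rule order_tendstoD(2)[rotated])
    moreover have "\<forall>\<^sub>F n in sequentially. R \<le> real n"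
      using eventually_ge_at_top[of "nat \<lceil>R\<rceil>"] by eventually_elim linarith
    ultimately show "\<forall>\<^sub>F n in sequentially. \<forall>x\<in>cball q R. dist (g n x) (f x) < e"
    proof eventually_elim
      case (elim n)
      show ?case
      proof
        fix x assume "x \<in> cball q R"
        then have "x \<in> cball q (real n)" using elim by simp
        from g(3)[OF this] elim show "dist (g n x) (f x) < e"
          by (simp add: dist_real_def)
      qed
    qed
  qed
  with g that show ?thesis by blast
qed

text \<open>An embedded point is picked in each neighbourhood of the sequence. The constants
  \<open>k n\<close> appear because only classes modulo constants converge; the distance functions
  themselves may tend to infinity.\<close>

lemma hcompact_seq:
  assumes "f \<in> CX" "fclass f \<in> hcompact"
  obtains x k where "\<And>R. uniform_limit (cball q R) (\<lambda>n y. dist (x n) y + k n) f sequentially"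
proof -
  have "\<exists>x. hembed x \<in> Cstar_nbhd q f (real n) (inverse (real (Suc n)))" for n
  proof -
    have "fclass f \<in> Cstar_nbhd q f (real n) (inverse (real (Suc n)))"
      using assms by (intro fclass_in_Cstar_nbhd) auto
    moreover have "\<And>T. fclass f \<in> T \<and> openin Cstar_topology T \<Longrightarrow> \<exists>P\<in>range hembed. P \<in> T"
      using assms(2) by (simp add: hcompact_def in_closure_of)
    ultimately show ?thesis
      using openin_Cstar_nbhd[of q f "real n"] by (metis rangeE)
  qed
  then obtain x where "\<And>n. hembed (x n) \<in> Cstar_nbhd q f (real n) (inverse (real (Suc n)))"
    by metis
  from Cstar_nbhd_seq[OF this] obtain g where g: "\<And>n. g n \<in> CX"
      "\<And>n. hembed (x n) = fclass (g n)" "\<And>R. uniform_limit (cball q R) g f sequentially"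
    by blast
  have "\<exists>k. \<forall>y. g n y = dist (x n) y + k" for n
  proof -
    have "g n \<in> fclass (\<lambda>y. dist (x n) y)"
      using fclass_self[OF g(1)[of n]] g(2)[of n] unfolding hembed_def by metis
    then show ?thesis
      unfolding fclass_iff by blast
  qed
  then obtain k where "\<And>n y. g n y = dist (x n) y + k n"
    by metis
  then have "g = (\<lambda>n y. dist (x n) y + k n)"
    by auto
  with g(3) that show ?thesis by blast
qed

lemma hembed_eq_fclassD:
  assumes "f \<in> CX" "fclass f = hembed x"
  obtains k where "f = (\<lambda>y. dist x y + k)"
proof -
  have "f \<in> fclass (\<lambda>y. dist x y)"
    using fclass_self[OF assms(1)] assms(2) by (simp add: hembed_def)
  with that show ?thesis by (auto simp: fclass_iff)
qed

lemma uniform_limit_cball_pointwise: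
  assumes "\<And>R. uniform_limit (cball q R) g f F"
  shows "((\<lambda>n. g n y) \<longlongrightarrow> f y) F"
  using tendsto_uniform_limitI[OF assms[of "dist q y"], of y] by simp

lemma convex_lipschitz_hcompact:
  fixes f :: "'a::busemann_space \<Rightarrow> real"
  assumes "f \<in> CX" "fclass f \<in> hcompact"
  shows "convex_lipschitz f"
proof -
  obtain x k where "\<And>R. uniform_limit (cball undefined R) (\<lambda>n y. dist (x n) y + k n) f sequentially"
    using hcompact_seq[OF assms, of undefined] by blast
  from uniform_limit_cball_pointwise[OF this] show ?thesis
    by (rule convex_lipschitz_limit[OF convex_lipschitz_dist])
qed

lemma hembed_in_hcompact: "hembed x \<in> hcompact"
proof -
  have "hembed y \<in> topspace Cstar_topology" for y :: 'a
  proof -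
    have "hembed y \<in> Cstar_nbhd y (\<lambda>z. dist y z) 0 1"
      unfolding hembed_def by (rule fclass_in_Cstar_nbhd[OF CX_dist]) simp
    then show ?thesis
      using openin_subset[OF openin_Cstar_nbhd] by blast
  qed
  then have "range hembed \<subseteq> (topspace Cstar_topology :: ('a \<Rightarrow> real) set set)"
    by blast
  from closure_of_subset[OF this] show ?thesis
    unfolding hcompact_def by blast
qed

section \<open>The extension of the identity to the compactifications\<close>

text \<open>The length of the path to \<open>z\<close> travelled up to time \<open>s\<close>. It
  stops growing at an endpoint in the space, so that points and ideal points can be treated
  alike.\<close>

fun gcap :: "'a::metric_space \<Rightarrow> 'a gpoint \<Rightarrow> real \<Rightarrow> real" where
  "gcap q (Inl x) s = min s (dist q x)"
| "gcap q (Inr \<xi>) s = s"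

text \<open>The path to \<open>z\<close> is the curve of steepest descent of \<open>f\<close>.\<close>

definition descent_end :: "'a::metric_space \<Rightarrow> ('a \<Rightarrow> real) \<Rightarrow> 'a gpoint \<Rightarrow> bool" where
  "descent_end q f z \<longleftrightarrow> z \<in> gcompact \<and>
     (\<forall>s\<ge>0. dist q (gpath q z s) = gcap q z s \<and> f (gpath q z s) = f q - gcap q z s \<and>
        (\<forall>w\<in>cball q s. f q - f w \<le> gcap q z s))"

lemma gcap_le: "gcap q z s \<le> s"
  by (cases z) auto

lemma gcap_tendsto: "(\<sigma> \<longlongrightarrow> s) F \<Longrightarrow> ((\<lambda>n. gcap q z (\<sigma> n)) \<longlongrightarrow> gcap q z s) F"
  by (cases z) (auto intro!: tendsto_intros)

lemma gcap_le_gdist: "ereal (gcap q z s) \<le> gdist q z"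
  by (cases z) auto

lemma descent_endD:
  assumes "descent_end q f z" "0 \<le> s"
  shows "dist q (gpath q z s) = gcap q z s" "f (gpath q z s) = f q - gcap q z s"
    "dist q w \<le> s \<Longrightarrow> f q - f w \<le> gcap q z s"
  using assms by (auto simp: descent_end_def)

lemma descent_end_Inl:
  fixes q x :: "'a::busemann_space"
  shows "descent_end q (\<lambda>y. dist x y + k) (Inl x)"
  unfolding descent_end_def
proof (intro conjI allI impI ballI)
  fix s :: real assume s: "0 \<le> s"
  show "dist q (gpath q (Inl x) s) = gcap q (Inl x) s"
    using dist_base_gpath_Inl[OF s] by simp
  show "dist x (gpath q (Inl x) s) + k = dist x q + k - gcap q (Inl x) s"
    using dist_gpath_Inl_end[OF s, of q x] by (simp add: dist_commute)
  fix w assume "w \<in> cball q s"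
  then show "dist x q + k - (dist x w + k) \<le> gcap q (Inl x) s"
    using dist_triangle[of x q w] by (simp add: dist_commute)
qed (auto simp: gcompact_def)

text \<open>By \<open>descent_end\<close>, \<open>gcap q z s\<close> is the largest descent of
  \<open>f\<close> in the ball of radius \<open>s\<close> about \<open>q\<close>. Changing the
  function by at most \<open>e\<close> changes a descent by at most \<open>2 * e\<close>.\<close>

lemma descent_end_gcap_le:
  assumes f: "descent_end q f z" and g: "descent_end q g z'" and s: "0 \<le> s"
    and close: "\<And>w. w \<in> cball q s \<Longrightarrow> \<bar>g w - f w\<bar> \<le> e"
  shows "gcap q z' s \<le> gcap q z s + 2 * e"
proof -
  let ?w = "gpath q z' s"
  have w: "dist q ?w \<le> s"
    using descent_endD(1)[OF g s] gcap_le[of q z' s] by simp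
  have "\<bar>g q - f q\<bar> \<le> e" "\<bar>g ?w - f ?w\<bar> \<le> e"
    using close[of q] close[of ?w] w s by auto
  then show ?thesis
    using descent_endD(2)[OF g s] descent_endD(3)[OF f s w] by linarith
qed

section \<open>Limits of steepest descent paths in a proper space\<close>

locale proper_busemann =
  fixes p :: "'a::busemann_space"
  assumes proper: "\<And>(x::'a) r. compact (cball x r)"
begin

lemma bounded_subseq:
  fixes w :: "nat \<Rightarrow> 'a"
  assumes "\<And>n. dist p (w n) \<le> R"
  obtains r l where "strict_mono r" "(w \<circ> r) \<longlonglongrightarrow> l"
  using proper[of p R] assms unfolding compact_def by (metis mem_cball)

text \<open>Compact balls give the accumulation point. The \<open>g n\<close> are evaluated at
  moving points; their common Lipschitz constant allows \<open>w n\<close> to be replaced by the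
  limit point, so that pointwise convergence suffices.\<close>

lemma descent_subseq:
  fixes w :: "nat \<Rightarrow> 'a"
  assumes g: "\<And>n. convex_lipschitz (g n)" and gf: "\<And>y. (\<lambda>n. g n y) \<longlonglongrightarrow> f y"
    and \<sigma>: "\<sigma> \<longlonglongrightarrow> s" and w: "\<And>n. dist p (w n) = \<sigma> n" "\<And>n. g n (w n) = g n p - \<sigma> n"
  obtains r l where "strict_mono r" "(w \<circ> r) \<longlonglongrightarrow> l" "dist p l = s" "f l = f p - s"
proof -
  obtain R where R: "\<And>n. norm (\<sigma> n) \<le> R"
    using convergent_imp_Bseq[OF convergentI[OF \<sigma>]] unfolding Bseq_def by blast
  have "dist p (w n) \<le> R" for n
    using R[of n] w(1)[of n] by simp
  then obtain r l where r: "strict_mono r" and l: "(w \<circ> r) \<longlonglongrightarrow> l"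
    using bounded_subseq by blast
  have \<sigma>r: "(\<lambda>n. \<sigma> (r n)) \<longlonglongrightarrow> s"
    using LIMSEQ_subseq_LIMSEQ[OF \<sigma> r] by (simp add: o_def)
  have gr: "(\<lambda>n. g (r n) y) \<longlonglongrightarrow> f y" for y
    using LIMSEQ_subseq_LIMSEQ[OF gf r] by (simp add: o_def)
  have "(\<lambda>n. dist p (w (r n))) \<longlonglongrightarrow> dist p l"
    using tendsto_dist[OF tendsto_const l] by (simp add: o_def)
  with \<sigma>r have 1: "dist p l = s"
    using w(1) LIMSEQ_unique by fastforce
  have "(\<lambda>n. dist (w (r n)) l) \<longlonglongrightarrow> 0"
    using tendsto_dist[OF l tendsto_const[of l]] by (simp add: o_def)
  then have "(\<lambda>n. g (r n) (w (r n)) - g (r n) l) \<longlonglongrightarrow> 0"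
    by (rule Lim_null_comparison[rotated]) (use convex_lipschitzD(1)[OF g] in simp)
  from tendsto_add[OF this gr[of l]] have "(\<lambda>n. g (r n) p - \<sigma> (r n)) \<longlonglongrightarrow> f l"
    by (simp add: w(2))
  moreover have "(\<lambda>n. g (r n) p - \<sigma> (r n)) \<longlonglongrightarrow> f p - s"
    by (intro tendsto_intros gr \<sigma>r)
  ultimately have "f l = f p - s"
    by (rule LIMSEQ_unique)
  with r l 1 that show ?thesis by blast
qed

text \<open>By \<open>descent_subseq\<close>, every subsequence has a further one that converges to
  a point of steepest descent of \<open>f\<close>; such a point is unique, so it is always
  \<open>l\<close>.\<close>

lemma descent_tendsto:
  fixes w :: "nat \<Rightarrow> 'a"
  assumes g: "\<And>n. convex_lipschitz (g n)" and gf: "\<And>y. (\<lambda>n. g n y) \<longlonglongrightarrow> f y"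
    and \<sigma>: "\<sigma> \<longlonglongrightarrow> s" and w: "\<And>n. dist p (w n) = \<sigma> n" "\<And>n. g n (w n) = g n p - \<sigma> n"
    and l: "dist p l \<le> s" "f l = f p - s"
  shows "w \<longlonglongrightarrow> l"
proof (rule ccontr)
  assume "\<not> ?thesis"
  then obtain e where e: "e > 0" "\<not> (\<forall>\<^sub>F n in sequentially. dist (w n) l < e)"
    by (auto simp: tendsto_iff)
  from not_eventually_sequentiallyD[OF e(2)]
  obtain r :: "nat \<Rightarrow> nat" where r: "strict_mono r" "\<And>n. \<not> dist (w (r n)) l < e"
    by blast
  obtain r' l' where r': "strict_mono r'" "((\<lambda>n. w (r n)) \<circ> r') \<longlonglongrightarrow> l'" "dist p l' = s" "f l' = f p - s"
  proof (rule descent_subseq[of "\<lambda>n. g (r n)" f "\<lambda>n. \<sigma> (r n)" s "\<lambda>n. w (r n)"])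
    show "(\<lambda>n. g (r n) y) \<longlonglongrightarrow> f y" for y
      using LIMSEQ_subseq_LIMSEQ[OF gf r(1)] by (simp add: o_def)
    show "(\<lambda>n. \<sigma> (r n)) \<longlonglongrightarrow> s"
      using LIMSEQ_subseq_LIMSEQ[OF \<sigma> r(1)] by (simp add: o_def)
  qed (use g w in auto)
  have "convex_lipschitz f"
    using g gf by (rule convex_lipschitz_limit)
  from steepest_descent_unique[OF this, of p l' s l] have "l' = l"
    using r' l by simp
  with tendstoD[OF r'(2) e(1)] have "\<forall>\<^sub>F n in sequentially. dist (w (r (r' n))) l < e"
    by simp
  with r(2) have "\<forall>\<^sub>F n in sequentially. False"
    by simp
  then show False by simp
qed

lemma limit_ray:
  assumes x: "filterlim (\<lambda>n. dist p (x n)) at_top sequentially"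
    and c: "\<And>s. 0 \<le> s \<Longrightarrow> (\<lambda>n. gpath p (Inl (x n)) s) \<longlonglongrightarrow> c s"
  shows "is_ray c" "c 0 = p"
proof -
  have far: "\<forall>\<^sub>F n in sequentially. s \<le> dist p (x n)" for s
    using x by (simp add: filterlim_at_top)
  show "is_ray c"
    unfolding is_ray_def
  proof (intro allI impI)
    fix s t :: real assume st: "0 \<le> s" "0 \<le> t"
    have "(\<lambda>n. dist (gpath p (Inl (x n)) s) (gpath p (Inl (x n)) t)) \<longlonglongrightarrow> dist (c s) (c t)"
      by (intro tendsto_dist c st)
    moreover have "\<forall>\<^sub>F n in sequentially.
        dist (gpath p (Inl (x n)) s) (gpath p (Inl (x n)) t) = \<bar>s - t\<bar>"
      using far[of s] far[of t]
      by eventually_elim (rule dist_gpath_Inl; use st in simp)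
    ultimately have "(\<lambda>n::nat. \<bar>s - t\<bar>) \<longlonglongrightarrow> dist (c s) (c t)"
      by (rule Lim_transform_eventually)
    then show "dist (c s) (c t) = \<bar>s - t\<bar>"
      by (simp add: LIMSEQ_const_iff)
  qed
  have "(\<lambda>n. gpath p (Inl (x n)) 0) \<longlonglongrightarrow> c 0"
    by (rule c) simp
  then show "c 0 = p"
    by (simp add: gpath_Inl LIMSEQ_const_iff)
qed

text \<open>A subsequence of the \<open>x n\<close> in a ball would accumulate at some
  \<open>l\<close>, and \<open>f\<close> would differ from the distance to \<open>l\<close> by a
  constant.\<close>

lemma horofunction_escape:
  assumes f: "f \<in> CX" and not: "fclass f \<notin> range hembed"
    and lim: "\<And>R. uniform_limit (cball p R) (\<lambda>n y. dist (x n) y + k n) f sequentially"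
  shows "filterlim (\<lambda>n. dist p (x n)) at_top sequentially"
proof (rule ccontr)
  assume "\<not> ?thesis"
  then obtain R where "\<not> (\<forall>\<^sub>F n in sequentially. R \<le> dist p (x n))"
    by (auto simp: filterlim_at_top)
  from not_eventually_sequentiallyD[OF this]
  obtain r :: "nat \<Rightarrow> nat" where r: "strict_mono r" "\<And>n. \<not> R \<le> dist p (x (r n))"
    by blast
  then have "dist p (x (r n)) \<le> R" for n
    using less_imp_le not_le by blast
  then obtain r' l where r': "strict_mono r'" "((\<lambda>n. x (r n)) \<circ> r') \<longlonglongrightarrow> l"
    using bounded_subseq[of "\<lambda>n. x (r n)" R] by blast
  have *: "(\<lambda>n. dist (x (r (r' n))) y + k (r (r' n))) \<longlonglongrightarrow> f y" for y
    using LIMSEQ_subseq_LIMSEQ[OF uniform_limit_cball_pointwise[OF lim] strict_mono_o[OF r(1) r'(1)]]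
    by (simp add: o_def)
  have "f y = dist l y + (f p - dist l p)" for y
  proof -
    \<comment> \<open>Subtracting the values at \<open>p\<close> cancels the unknown constants
      \<open>k\<close>.\<close>
    have "(\<lambda>n. (dist (x (r (r' n))) y + k (r (r' n))) - (dist (x (r (r' n))) p + k (r (r' n))))
        \<longlonglongrightarrow> f y - f p"
      by (intro tendsto_diff *)
    moreover have "(\<lambda>n. dist (x (r (r' n))) y - dist (x (r (r' n))) p) \<longlonglongrightarrow> dist l y - dist l p"
      using r'(2) by (intro tendsto_intros) (simp_all add: o_def)
    ultimately have "f y - f p = dist l y - dist l p"
      by (intro LIMSEQ_unique) simp_all
    then show ?thesis by simp
  qed
  then have "f = (\<lambda>y. dist l y + (f p - dist l p))"
    by blast
  then have "fclass f = hembed l"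
    unfolding hembed_def by (metis fclass_add CX_dist)
  with not show False by blast
qed

text \<open>An embedded class has its own point as end. Otherwise the approximating points escape,
  and the points at time \<open>s\<close> on the segments towards them converge to the unique point
  of steepest descent; these limits form a ray. The clause on \<open>hembed\<close> later makes the
  assignment an extension of the identity.\<close>

lemma descent_end_exists:
  assumes f: "f \<in> CX" "fclass f \<in> hcompact"
  shows "\<exists>z. descent_end p f z \<and> (\<forall>x. fclass f = hembed x \<longrightarrow> z = Inl x)"
proof (cases "fclass f \<in> range hembed")
  case True
  then obtain x where x: "fclass f = hembed x" by blast
  then obtain k where "f = (\<lambda>y. dist x y + k)"
    using hembed_eq_fclassD[OF f(1)] by blast
  then have "descent_end p f (Inl x)"
    using descent_end_Inl by blast
  moreover have "\<forall>y. fclass f = hembed y \<longrightarrow> Inl x = Inl y"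
    using x hembed_inj by metis
  ultimately show ?thesis by blast
next
  case False
  obtain x k where lim: "\<And>R. uniform_limit (cball p R) (\<lambda>n y. dist (x n) y + k n) f sequentially"
    using hcompact_seq[OF f] by blast
  note pointwise = uniform_limit_cball_pointwise[OF lim]
  have far: "filterlim (\<lambda>n. dist p (x n)) at_top sequentially"
    using horofunction_escape[OF f(1) False lim] .
  have cap: "(\<lambda>n. min s (dist p (x n))) \<longlonglongrightarrow> s" for s
  proof -
    have "\<forall>\<^sub>F n in sequentially. s \<le> dist p (x n)"
      using far by (simp add: filterlim_at_top)
    then have "\<forall>\<^sub>F n in sequentially. s = min s (dist p (x n))"
      by eventually_elim simp
    with tendsto_const show ?thesis
      by (rule Lim_transform_eventually)
  qed
  have path: "dist p (gpath p (Inl (x n)) s) = min s (dist p (x n))"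
    "dist (x n) (gpath p (Inl (x n)) s) + k n = dist (x n) p + k n - min s (dist p (x n))"
    if "0 \<le> s" for s n
    using descent_endD(1,2)[OF descent_end_Inl[where x = "x n" and k = "k n" and q = p] that] by simp_all
  have "\<exists>w. dist p w = s \<and> f w = f p - s" if "0 \<le> s" for s
    using descent_subseq[OF convex_lipschitz_dist pointwise cap path[OF that]] by metis
  then obtain c where c: "\<And>s. 0 \<le> s \<Longrightarrow> dist p (c s) = s" "\<And>s. 0 \<le> s \<Longrightarrow> f (c s) = f p - s"
    by metis
  have "(\<lambda>n. gpath p (Inl (x n)) s) \<longlonglongrightarrow> c s" if "0 \<le> s" for s
    using descent_tendsto[OF convex_lipschitz_dist pointwise cap path[OF that], of "c s"] c that
    by simp
  from limit_ray[OF far this] have ray: "is_ray c" "c 0 = p" by auto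
  have "gpath p (Inr (ray_end c)) s = c s" if "0 \<le> s" for s
    using ray_from_ray_end[OF ray(1) that] ray(2) by simp
  moreover have "f p - f w \<le> s" if "dist p w \<le> s" for w s
    using convex_lipschitzD(1)[OF convex_lipschitz_hcompact[OF f], of p w] that by linarith
  ultimately have "descent_end p f (Inr (ray_end c))"
    using c ray_end_gboundary[OF ray(1)] by (auto simp: descent_end_def gcompact_def)
  moreover have "\<forall>x. fclass f \<noteq> hembed x"
    using False by blast
  ultimately show ?thesis by blast
qed

text \<open>Steepest descent paths depend continuously on the function: the lengths
  \<open>gcap\<close> converge as maximal descents and determine \<open>gdist\<close>, and the paths
  converge because points of steepest descent are unique.\<close>

lemma descent_end_cone_converges:
  assumes g: "\<And>n. convex_lipschitz (g n)" "\<And>n. descent_end p (g n) (z n)"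
    and f: "descent_end p f w"
    and lim: "\<And>R. uniform_limit (cball p R) g f sequentially"
  shows "cone_converges p z w"
proof -
  note pointwise = uniform_limit_cball_pointwise[OF lim]
  have cl: "convex_lipschitz f"
    using g(1) pointwise by (rule convex_lipschitz_limit)
  have cap: "\<forall>\<^sub>F n in sequentially. \<forall>s\<in>{0..R}. \<bar>gcap p (z n) s - gcap p w s\<bar> \<le> e" if "e > 0" for R e
  proof -
    have "e / 2 > 0" using that by simp
    from uniform_limitD[OF lim this, of R] show ?thesis
    proof eventually_elim
      case (elim n)
      show ?case
      proof
        fix s assume s: "s \<in> {0..R}"
        have close: "\<bar>g n y - f y\<bar> \<le> e / 2" "\<bar>f y - g n y\<bar> \<le> e / 2" if "y \<in> cball p s" for y
          using elim[rule_format, of y] that s by (auto simp: dist_real_def abs_minus_commute)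
        from descent_end_gcap_le[OF f g(2)[of n] _ close(1), of s]
          descent_end_gcap_le[OF g(2)[of n] f _ close(2), of s] s
        show "\<bar>gcap p (z n) s - gcap p w s\<bar> \<le> e"
          by (auto simp: abs_le_iff)
      qed
    qed
  qed
  have cap_lim: "(\<lambda>n. gcap p (z n) s) \<longlonglongrightarrow> gcap p w s" if "0 \<le> s" for s
    unfolding tendsto_iff
  proof (intro allI impI)
    fix e :: real assume "e > 0"
    then have "e / 2 > 0" by simp
    from cap[OF this, of s] show "\<forall>\<^sub>F n in sequentially. dist (gcap p (z n) s) (gcap p w s) < e"
      by eventually_elim (use \<open>e > 0\<close> that in \<open>force simp: dist_real_def\<close>)
  qed
  have "(\<lambda>n. gdist p (z n)) \<longlonglongrightarrow> gdist p w"
  proof (cases w)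
    case (Inl x)
    \<comment> \<open>Just past the endpoint \<open>x\<close> the limit of \<open>gcap\<close> is
      below its argument, so eventually \<open>z n\<close> is a point of the space and
      \<open>gcap\<close> is its distance from \<open>p\<close>.\<close>
    let ?s = "dist p x + 1"
    have lim': "(\<lambda>n. gcap p (z n) ?s) \<longlonglongrightarrow> dist p x"
      using cap_lim[of ?s] Inl by simp
    have "\<forall>\<^sub>F n in sequentially. gcap p (z n) ?s < ?s"
      using lim' by (rule order_tendstoD) simp
    then have "\<forall>\<^sub>F n in sequentially. ereal (gcap p (z n) ?s) = gdist p (z n)"
    proof eventually_elim
      case (elim n) then show ?case by (cases "z n") auto
    qed
    moreover have "(\<lambda>n. ereal (gcap p (z n) ?s)) \<longlonglongrightarrow> ereal (dist p x)"
      using lim' by simp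
    ultimately have "(\<lambda>n. gdist p (z n)) \<longlonglongrightarrow> ereal (dist p x)"
      by (rule Lim_transform_eventually[rotated])
    with Inl show ?thesis by simp
  next
    case (Inr \<xi>)
    have "\<forall>\<^sub>F n in sequentially. ereal r < gdist p (z n)" for r
    proof -
      have "(\<lambda>n. gcap p (z n) (\<bar>r\<bar> + 1)) \<longlonglongrightarrow> \<bar>r\<bar> + 1"
        using cap_lim[of "\<bar>r\<bar> + 1"] Inr by simp
      then have "\<forall>\<^sub>F n in sequentially. r < gcap p (z n) (\<bar>r\<bar> + 1)"
        by (rule order_tendstoD) simp
      then show ?thesis
        by eventually_elim (metis gcap_le_gdist less_ereal.simps(1) less_le_trans)
    qed
    with Inr show ?thesis
      by (simp add: tendsto_PInfty)
  qed
  moreover have "uniform_limit {0..R} (\<lambda>n. gpath p (z n)) (gpath p w) sequentially" for R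
  proof (rule ccontr)
    assume "\<not> ?thesis"
    then obtain e where e: "e > 0"
        "\<not> (\<forall>\<^sub>F n in sequentially. \<forall>s\<in>{0..R}. dist (gpath p (z n) s) (gpath p w s) < e)"
      by (auto simp: uniform_limit_iff)
    from not_eventually_sequentiallyD[OF e(2)]
    obtain r :: "nat \<Rightarrow> nat" where r: "strict_mono r"
        "\<And>n. \<exists>s\<in>{0..R}. \<not> dist (gpath p (z (r n)) s) (gpath p w s) < e"
      by blast
    then obtain s where s: "\<And>n. s n \<in> {0..R}"
        "\<And>n. \<not> dist (gpath p (z (r n)) (s n)) (gpath p w (s n)) < e"
      by metis
    \<comment> \<open>Uniform convergence fails at the times \<open>s n\<close>. Along a subsequence
      they tend to \<open>t\<close>, and both paths at these times converge to the single point
      \<open>gpath p w t\<close>.\<close>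
    obtain r' t where r': "strict_mono r'" "(s \<circ> r') \<longlonglongrightarrow> t" "t \<in> {0..R}"
      using s(1) compact_Icc[of 0 R] unfolding compact_def by metis
    have s': "(\<lambda>n. s (r' n)) \<longlonglongrightarrow> t"
      using r'(2) by (simp add: o_def)
    have s0: "0 \<le> s (r' n)" for n
      using s(1)[of "r' n"] by simp
    have rr: "strict_mono (r \<circ> r')"
      using r(1) r'(1) by (rule strict_mono_o)
    have w: "dist p (gpath p w t) \<le> gcap p w t" "f (gpath p w t) = f p - gcap p w t"
      using descent_endD(1,2)[OF f, of t] r'(3) by auto
    have 1: "(\<lambda>n. gcap p w (s (r' n))) \<longlonglongrightarrow> gcap p w t"
      using s' by (rule gcap_tendsto)
    have "(\<lambda>n. gcap p (z (r (r' n))) (s (r' n)) - gcap p w (s (r' n))) \<longlonglongrightarrow> 0"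
      unfolding tendsto_iff
    proof (intro allI impI)
      fix e :: real assume "e > 0"
      then have "e / 2 > 0" by simp
      from eventually_subseq[OF rr cap[OF this, of R]]
      show "\<forall>\<^sub>F n in sequentially.
          dist (gcap p (z (r (r' n))) (s (r' n)) - gcap p w (s (r' n))) 0 < e"
      proof eventually_elim
        case (elim n)
        with s(1)[of "r' n"] \<open>e > 0\<close> show ?case
          by (force simp: dist_real_def)
      qed
    qed
    from tendsto_add[OF this 1]
    have 2: "(\<lambda>n. gcap p (z (r (r' n))) (s (r' n))) \<longlonglongrightarrow> gcap p w t"
      by simp
    \<comment> \<open>Continuity of the path to \<open>w\<close> is the case of a constant sequence
      of functions.\<close>
    have "(\<lambda>n. gpath p w (s (r' n))) \<longlonglongrightarrow> gpath p w t"
      by (rule descent_tendsto[OF cl tendsto_const 1])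
        (use descent_endD(1,2)[OF f s0] w in auto)
    moreover have "(\<lambda>n. gpath p (z (r (r' n))) (s (r' n))) \<longlonglongrightarrow> gpath p w t"
    proof (rule descent_tendsto[where g = "\<lambda>n. g (r (r' n))", OF g(1) _ 2])
      show "(\<lambda>n. g (r (r' n)) y) \<longlonglongrightarrow> f y" for y
        using LIMSEQ_subseq_LIMSEQ[OF pointwise rr] by (simp add: o_def)
    qed (use descent_endD(1,2)[OF g(2) s0] w in auto)
    ultimately have "(\<lambda>n. dist (gpath p (z (r (r' n))) (s (r' n))) (gpath p w (s (r' n))))
        \<longlonglongrightarrow> dist (gpath p w t) (gpath p w t)"
      by (intro tendsto_dist)
    then have "\<forall>\<^sub>F n in sequentially.
        dist (gpath p (z (r (r' n))) (s (r' n))) (gpath p w (s (r' n))) < e"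
      using e(1) by (intro order_tendstoD(2)) auto
    with s(2) have "\<forall>\<^sub>F n in sequentially. False"
      by simp
    then show False by simp
  qed
  ultimately show ?thesis
    by (simp add: cone_converges_def)
qed

end

lemma descent_end_fclass:
  assumes "descent_end q f z" "f \<in> CX" "g \<in> CX" "fclass f = fclass g"
  shows "descent_end q g z"
proof -
  have "g \<in> fclass f"
    using fclass_self[OF assms(3)] assms(4) by simp
  then obtain k where "\<And>x. g x = f x + k"
    unfolding fclass_iff by blast
  with assms(1) show ?thesis
    by (simp add: descent_end_def)
qed

lemma hcompact_topspace: "hcompact \<subseteq> topspace Cstar_topology"
  unfolding hcompact_def by (rule closure_of_subset_topspace)

lemma hcompact_fclass:
  assumes "P \<in> hcompact"
  obtains f where "f \<in> CX" "P = fclass f"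
proof -
  have "Cstar_open (topspace Cstar_topology :: ('a \<Rightarrow> real) set set)"
    using openin_topspace[of Cstar_topology] by (simp only: openin_Cstar_topology)
  with assms hcompact_topspace have "P \<in> Cstar"
    unfolding Cstar_open_def by blast
  with that show ?thesis
    unfolding Cstar_def fclass_def by (auto elim: quotientE)
qed

section \<open>Open sets of the cone topology\<close>

lemma topspace_cone_topology: "topspace (cone_topology q) = gcompact"
proof
  have "cone_open q (topspace (cone_topology q))"
    using openin_topspace[of "cone_topology q"] by (simp only: openin_cone_topology)
  then show "topspace (cone_topology q) \<subseteq> gcompact"
    by (simp add: cone_open_def)
  have "openin (cone_topology q) gcompact"
    by (auto simp: openin_cone_topology cone_open_def intro!: always_eventually)
  then show "gcompact \<subseteq> topspace (cone_topology q)"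
    by (rule openin_subset)
qed

lemma openin_cone_neighbourhood:
  assumes "0 \<le> K"
  shows "openin (cone_topology q) {z \<in> gcompact. ereal K < gdist q z \<and> dist (gpath q z K) y < e}"
  unfolding openin_cone_topology cone_open_def
proof (intro conjI allI impI)
  fix z w
  assume z: "range z \<subseteq> gcompact"
    and w: "w \<in> {z \<in> gcompact. ereal K < gdist q z \<and> dist (gpath q z K) y < e}"
    and conv: "cone_converges q z w"
  have "uniform_limit {0..K} (\<lambda>i. gpath q (z i)) (gpath q w) sequentially"
    using conv assms by (simp add: cone_converges_def)
  from tendsto_uniform_limitI[OF this, of K]
  have "(\<lambda>i. gpath q (z i) K) \<longlonglongrightarrow> gpath q w K"
    using assms by simp
  then have "(\<lambda>i. dist (gpath q (z i) K) y) \<longlonglongrightarrow> dist (gpath q w K) y"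
    by (intro tendsto_intros)
  then have "\<forall>\<^sub>F i in sequentially. dist (gpath q (z i) K) y < e"
    using w by (intro order_tendstoD) auto
  moreover have "\<forall>\<^sub>F i in sequentially. ereal K < gdist q (z i)"
    using conv w unfolding cone_converges_def by (intro order_tendstoD) auto
  ultimately show "\<forall>\<^sub>F i in sequentially.
      z i \<in> {z \<in> gcompact. ereal K < gdist q z \<and> dist (gpath q z K) y < e}"
    by eventually_elim (use z in auto)
qed auto

text \<open>Rays outside \<open>U\<close> with deviation at most 1 at times tending to infinity
  would converge to \<xi> by \<open>dist_rays_shrink\<close>, against the openness of
  \<open>U\<close>. Every \<open>K\<close> beyond \<open>K0\<close> is allowed, so that one
  \<open>K\<close> can serve two neighbourhoods.\<close>

lemma cone_neighbourhood_rays: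
  fixes q :: "'a::busemann_space"
  assumes U: "openin (cone_topology q) U" "Inr \<xi> \<in> U"
    and ray: "is_ray (ray_from q \<xi>)" "ray_from q \<xi> 0 = q"
  obtains K0 where "\<And>K c. K0 \<le> K \<Longrightarrow> is_ray c \<Longrightarrow> c 0 = q \<Longrightarrow>
    dist (c K) (ray_from q \<xi> K) \<le> 1 \<Longrightarrow> Inr (ray_end c) \<in> U"
proof -
  \<comment> \<open>\<open>Suc n\<close> rather than \<open>n\<close> keeps the times
    \<open>K n\<close> positive, as the division in the shrinking estimate requires.\<close>
  have "\<exists>n::nat. \<forall>K c. real (Suc n) \<le> K \<longrightarrow> is_ray c \<longrightarrow> c 0 = q \<longrightarrow>
      dist (c K) (ray_from q \<xi> K) \<le> 1 \<longrightarrow> Inr (ray_end c) \<in> U"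
  proof (rule ccontr)
    assume "\<not> ?thesis"
    then have "\<forall>n. \<exists>K c. real (Suc n) \<le> K \<and> is_ray c \<and> c 0 = q \<and>
        dist (c K) (ray_from q \<xi> K) \<le> 1 \<and> Inr (ray_end c) \<notin> U"
      by blast
    then obtain K c where c: "\<And>n. real (Suc n) \<le> K n" "\<And>n. is_ray (c n)" "\<And>n. c n 0 = q"
        "\<And>n. dist (c n (K n)) (ray_from q \<xi> (K n)) \<le> 1" "\<And>n. Inr (ray_end (c n)) \<notin> U"
      by metis
    have "uniform_limit {0..R} (\<lambda>n. gpath q (Inr (ray_end (c n)))) (gpath q (Inr \<xi>)) sequentially"
      if R: "0 \<le> R" for R
      unfolding uniform_limit_iff
    proof (intro allI impI)
      fix e :: real assume "e > 0"
      have "(\<lambda>n. R * inverse (real (Suc n))) \<longlonglongrightarrow> R * 0"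
        by (intro tendsto_intros LIMSEQ_inverse_real_of_nat)
      then have "\<forall>\<^sub>F n in sequentially. R * inverse (real (Suc n)) < e"
        using \<open>e > 0\<close> by (intro order_tendstoD) auto
      moreover have "\<forall>\<^sub>F n in sequentially. R \<le> real (Suc n)"
        using eventually_ge_at_top[of "nat \<lceil>R\<rceil>"] by eventually_elim linarith
      ultimately show "\<forall>\<^sub>F n in sequentially. \<forall>s\<in>{0..R}.
          dist (gpath q (Inr (ray_end (c n))) s) (gpath q (Inr \<xi>) s) < e"
      proof eventually_elim
        case (elim n)
        show ?case
        proof
          fix s assume s: "s \<in> {0..R}"
          have K: "0 < K n" "s \<le> K n"
            using c(1)[of n] elim s by auto
          have "dist (c n s) (ray_from q \<xi> s) \<le> s / K n * dist (c n (K n)) (ray_from q \<xi> (K n))"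
            using dist_rays_shrink[OF c(2)[of n] ray(1), of s "K n"] c(3) ray(2) s K by simp
          also have "\<dots> \<le> s / K n * 1"
            using c(4) s K by (intro mult_left_mono) auto
          also have "\<dots> \<le> R * inverse (real (Suc n))"
            using frac_le[of R s "real (Suc n)" "K n"] c(1)[of n] s by (simp add: divide_inverse)
          also have "\<dots> < e"
            by (rule elim)
          finally show "dist (gpath q (Inr (ray_end (c n))) s) (gpath q (Inr \<xi>) s) < e"
            using ray_from_ray_end[OF c(2)[of n], of s] c(3)[of n] s by simp
        qed
      qed
    qed
    then have "cone_converges q (\<lambda>n. Inr (ray_end (c n))) (Inr \<xi>)"
      by (simp add: cone_converges_def)
    moreover have "range (\<lambda>n. Inr (ray_end (c n))) \<subseteq> (gcompact :: 'a gpoint set)"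
      using ray_end_gboundary[OF c(2)] by (auto simp: gcompact_def)
    ultimately have "\<forall>\<^sub>F n in sequentially. Inr (ray_end (c n)) \<in> U"
      using U unfolding openin_cone_topology cone_open_def by blast
    with c(5) show False by simp
  qed
  with that show ?thesis by blast
qed

section \<open>The continuous extension and the rays towards images of horofunctions\<close>

context proper_busemann
begin

text \<open>A class is sent to the end of its steepest descent path from \<open>p\<close>. If
  continuity failed, classes in ever smaller neighbourhoods would have images avoiding
  \<open>U\<close>, whereas \<open>descent_end_cone_converges\<close> makes these images converge.
  Existence turns the choice in \<open>pi_hg\<close> into an actual continuous extension.\<close>

lemma continuous_extension_exists:
  "\<exists>F. continuous_map (subtopology Cstar_topology hcompact) (cone_topology p) F \<and>
     (\<forall>x. F (hembed x) = Inl x)"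
proof -
  have "\<exists>z. (\<exists>f\<in>CX. P = fclass f \<and> descent_end p f z) \<and> (\<forall>x. P = hembed x \<longrightarrow> z = Inl x)"
    if "P \<in> hcompact" for P :: "('a \<Rightarrow> real) set"
  proof -
    obtain f where "f \<in> CX" "P = fclass f"
      using hcompact_fclass[OF \<open>P \<in> hcompact\<close>] by blast
    then show ?thesis
      using descent_end_exists[of f] that by blast
  qed
  then obtain F where F: "\<And>P. P \<in> hcompact \<Longrightarrow> \<exists>f\<in>CX. P = fclass f \<and> descent_end p f (F P)"
      "\<And>P x. P \<in> hcompact \<Longrightarrow> P = hembed x \<Longrightarrow> F P = Inl x"
    by metis
  have F': "descent_end p f (F (fclass f))" if "f \<in> CX" "fclass f \<in> hcompact" for f
    using F(1)[OF that(2)] descent_end_fclass that(1) by metis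
  have gc: "F P \<in> gcompact" if "P \<in> hcompact" for P
    using F(1)[OF that] by (auto simp: descent_end_def)
  have top: "topspace (subtopology Cstar_topology hcompact) = (hcompact :: ('a \<Rightarrow> real) set set)"
    using hcompact_topspace by auto
  have "continuous_map (subtopology Cstar_topology hcompact) (cone_topology p) F"
    unfolding continuous_map_def top topspace_cone_topology
  proof (intro conjI allI impI)
    show "F \<in> hcompact \<rightarrow> gcompact"
      using gc by blast
    fix U assume U: "openin (cone_topology p) U"
    show "openin (subtopology Cstar_topology hcompact) {P \<in> hcompact. F P \<in> U}"
    proof (subst openin_subopen, intro ballI)
      fix P assume P: "P \<in> {P \<in> hcompact. F P \<in> U}"
      then obtain f where f: "f \<in> CX" "P = fclass f"
        using hcompact_fclass by blast
      let ?N = "\<lambda>n. Cstar_nbhd p f (real n) (inverse (real (Suc n)))"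
      have "\<exists>n. hcompact \<inter> ?N n \<subseteq> {P \<in> hcompact. F P \<in> U}"
      proof (rule ccontr)
        assume "\<not> ?thesis"
        then have "\<forall>n. \<exists>Q. Q \<in> hcompact \<and> Q \<in> ?N n \<and> F Q \<notin> U"
          by blast
        then obtain Q where Q: "\<And>n. Q n \<in> hcompact" "\<And>n. Q n \<in> ?N n" "\<And>n. F (Q n) \<notin> U"
          by metis
        from Cstar_nbhd_seq[OF Q(2)] obtain g where g: "\<And>n. g n \<in> CX" "\<And>n. Q n = fclass (g n)"
            "\<And>R. uniform_limit (cball p R) g f sequentially"
          by blast
        have h: "fclass (g n) \<in> hcompact" for n
          using Q(1)[of n] g(2)[of n] by simp
        have "cone_converges p (\<lambda>n. F (Q n)) (F P)"
        proof (rule descent_end_cone_converges[where g = g and f = f])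
          show "convex_lipschitz (g n)" for n
            using g(1) h by (rule convex_lipschitz_hcompact)
          show "descent_end p (g n) (F (Q n))" for n
            using F'[OF g(1) h, of n] g(2)[of n] by simp
          show "descent_end p f (F P)"
            using F'[OF f(1)] P f(2) by simp
        qed (rule g(3))
        moreover have "range (\<lambda>n. F (Q n)) \<subseteq> gcompact"
          using gc Q(1) by blast
        moreover have "F P \<in> U"
          using P by simp
        ultimately have "\<forall>\<^sub>F n in sequentially. F (Q n) \<in> U"
          using U unfolding openin_cone_topology cone_open_def by blast
        with Q(3) show False by simp
      qed
      then obtain n where n: "hcompact \<inter> ?N n \<subseteq> {P \<in> hcompact. F P \<in> U}" ..
      show "\<exists>T. openin (subtopology Cstar_topology hcompact) T \<and> P \<in> T \<and>
          T \<subseteq> {P \<in> hcompact. F P \<in> U}"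
      proof (intro exI conjI)
        show "openin (subtopology Cstar_topology hcompact) (hcompact \<inter> ?N n)"
          by (rule openin_subtopology_Int2) (rule openin_Cstar_nbhd)
        show "P \<in> hcompact \<inter> ?N n"
          using P f fclass_in_Cstar_nbhd[OF f(1)] by simp
      qed (rule n)
    qed
  qed
  moreover have "F (hembed x) = Inl x" for x
    using F(2)[OF hembed_in_hcompact] by simp
  ultimately show ?thesis by blast
qed

lemma pi_hg_properties:
  "continuous_map (subtopology Cstar_topology hcompact) (cone_topology p) (pi_hg p)"
  "pi_hg p (hembed x) = Inl x"
  using someI_ex[OF continuous_extension_exists] unfolding pi_hg_def by blast+

lemma pi_hg_tendsto:
  assumes f: "f \<in> CX" "fclass f \<in> hcompact"
    and lim: "\<And>R. uniform_limit (cball p R) (\<lambda>n y. dist (x n) y + k n) f sequentially"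
    and U: "openin (cone_topology p) U" "pi_hg p (fclass f) \<in> U"
  shows "\<forall>\<^sub>F n in sequentially. Inl (x n) \<in> U"
proof -
  have "openin (subtopology Cstar_topology hcompact)
      {P \<in> topspace (subtopology Cstar_topology hcompact). pi_hg p P \<in> U}"
    using pi_hg_properties(1) U(1) by (rule openin_continuous_map_preimage)
  then obtain W where W: "openin Cstar_topology W"
      "{P \<in> topspace (subtopology Cstar_topology hcompact). pi_hg p P \<in> U} = W \<inter> hcompact"
    unfolding openin_subtopology by blast
  have WU: "P \<in> W \<longleftrightarrow> pi_hg p P \<in> U" if "P \<in> hcompact" for P
    using that W(2) hcompact_topspace by auto
  have "CX_open {g \<in> CX. fclass g \<in> W}"
    using W(1) by (simp add: openin_Cstar_topology Cstar_open_def openin_CX_topology)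
  moreover have "f \<in> {g \<in> CX. fclass g \<in> W}"
    using f U(2) WU by blast
  ultimately obtain B e where B: "bounded B" "e > 0"
      "{g \<in> CX. \<forall>x\<in>B. \<bar>g x - f x\<bar> < e} \<subseteq> {g \<in> CX. fclass g \<in> W}"
    unfolding CX_open_def by blast
  obtain R where R: "B \<subseteq> cball p R"
    using bounded_subset_ballD[OF B(1), of p] ball_subset_cball by (metis order_trans)
  from uniform_limitD[OF lim B(2), of R] show ?thesis
  proof eventually_elim
    case (elim n)
    have "(\<lambda>y. dist (x n) y + k n) \<in> {g \<in> CX. \<forall>x\<in>B. \<bar>g x - f x\<bar> < e}"
      using elim R CX_add[OF CX_dist] by (auto simp: dist_real_def)
    then have "fclass (\<lambda>y. dist (x n) y + k n) \<in> W"
      using B(3) by blast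
    then have "hembed (x n) \<in> W"
      by (simp add: fclass_add[OF CX_dist] hembed_def)
    then show ?case
      using WU[OF hembed_in_hcompact] pi_hg_properties(2) by metis
  qed
qed

text \<open>By continuity of \<open>pi_hg\<close>, the segments from \<open>p\<close> to the
  approximating points converge to the path towards \<xi>, and along each of them the distance to
  its endpoint drops at rate 1. The limit inherits this for \<open>f\<close>.\<close>

lemma pi_hg_ray:
  assumes f: "horofunction f" and \<xi>: "pi_hg p (fclass f) = Inr \<xi>"
  shows "is_ray (ray_from p \<xi>)" "ray_from p \<xi> 0 = p"
    "0 \<le> s \<Longrightarrow> f (ray_from p \<xi> s) = f p - s"
proof -
  have CX: "f \<in> CX" and hc: "fclass f \<in> hcompact" and nr: "fclass f \<notin> range hembed"
    using f by (auto simp: horofunction_def hboundary_def)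
  obtain x k where lim: "\<And>R. uniform_limit (cball p R) (\<lambda>n y. dist (x n) y + k n) f sequentially"
    using hcompact_seq[OF CX hc] by blast
  have far: "filterlim (\<lambda>n. dist p (x n)) at_top sequentially"
    using horofunction_escape[OF CX nr lim] .
  have gc: "Inr \<xi> \<in> (gcompact :: 'a gpoint set)"
  proof -
    have "fclass f \<in> topspace (subtopology Cstar_topology hcompact)"
      using hc hcompact_topspace by auto
    then have "pi_hg p (fclass f) \<in> topspace (cone_topology p)"
      using continuous_map_image_subset_topspace[OF pi_hg_properties(1)] by blast
    then show ?thesis
      by (simp add: \<xi> topspace_cone_topology)
  qed
  have path: "(\<lambda>n. gpath p (Inl (x n)) s) \<longlonglongrightarrow> ray_from p \<xi> s" if s: "0 \<le> s" for s
    unfolding tendsto_iff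
  proof (intro allI impI)
    fix e :: real assume "e > 0"
    then have "pi_hg p (fclass f) \<in>
        {z \<in> gcompact. ereal s < gdist p z \<and> dist (gpath p z s) (ray_from p \<xi> s) < e}"
      using \<xi> gc by simp
    from pi_hg_tendsto[OF CX hc lim openin_cone_neighbourhood[OF s] this]
    show "\<forall>\<^sub>F n in sequentially. dist (gpath p (Inl (x n)) s) (ray_from p \<xi> s) < e"
      by eventually_elim simp
  qed
  \<comment> \<open>\<open>ray_from\<close> is a mere choice; it is a ray from \<open>p\<close>
    because it is a limit of segments whose lengths tend to infinity.\<close>
  show "is_ray (ray_from p \<xi>)" "ray_from p \<xi> 0 = p"
    using limit_ray[OF far path] by auto
  assume s: "0 \<le> s"
  let ?c = "ray_from p \<xi> s" and ?w = "\<lambda>n. gpath p (Inl (x n)) s"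
  have "(\<lambda>n. dist (?w n) ?c) \<longlonglongrightarrow> 0"
    using tendsto_dist[OF path[OF s] tendsto_const[of ?c]] by simp
  then have "(\<lambda>n. dist (x n) (?w n) - dist (x n) ?c) \<longlonglongrightarrow> 0"
    by (rule Lim_null_comparison[rotated])
      (auto intro!: always_eventually
        convex_lipschitzD(1)[OF convex_lipschitz_dist[where k = 0], simplified])
  from tendsto_add[OF this uniform_limit_cball_pointwise[OF lim, of ?c]]
  have 1: "(\<lambda>n. dist (x n) (?w n) + k n) \<longlonglongrightarrow> f ?c"
    by (simp add: algebra_simps)
  have "\<forall>\<^sub>F n in sequentially. s \<le> dist p (x n)"
    using far by (simp add: filterlim_at_top)
  then have "\<forall>\<^sub>F n in sequentially. dist (x n) p + k n - s = dist (x n) (?w n) + k n"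
  proof eventually_elim
    case (elim n)
    then show ?case
      using dist_gpath_Inl_end[OF s, of p "x n"] by (simp add: dist_commute)
  qed
  moreover have "(\<lambda>n. dist (x n) p + k n - s) \<longlonglongrightarrow> f p - s"
    by (intro tendsto_diff uniform_limit_cball_pointwise[OF lim] tendsto_const)
  ultimately have "(\<lambda>n. dist (x n) (?w n) + k n) \<longlonglongrightarrow> f p - s"
    by (rule Lim_transform_eventually[rotated])
  with 1 show "f ?c = f p - s"
    by (rule LIMSEQ_unique)
qed

end

section \<open>Triangles with a vertex on a ray\<close>

text \<open>Opposite directions would be \<open>2 * s\<close> apart, and \<gamma> measures the
  deficit. The longer segment is cut at the length of the shorter; convexity of the distance from
  the endpoint of the shorter one carries the deficit to the cut, and shrinking towards
  \<open>q\<close> carries it to time \<open>s\<close>.\<close>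

lemma dist_gpath_opposite:
  fixes q x y :: "'a::busemann_space"
  assumes s: "0 < s" "s \<le> dist q x" "s \<le> dist q y"
    and \<gamma>: "0 \<le> \<gamma>" and xy: "dist x y \<le> (1 - \<gamma>) * (dist q x + dist q y)"
  shows "dist (gpath q (Inl x) s) (gpath q (Inl y) s) \<le> 2 * s * (1 - \<gamma> / 2)"
  using s xy
proof (induction "dist q y" "dist q x" arbitrary: x y rule: linorder_wlog)
  case (le x y)
  let ?A = "dist q x" and ?B = "dist q y"
  have pos: "0 < ?B" "0 < ?A"
    using le by auto
  have "dist y (gpath q (Inl x) ?B) \<le> (1 - ?B / ?A) * ?B + ?B / ?A * dist y x"
    using dist_point_geo_le[of "?B / ?A" y q x] le pos gpath_Inl_geo[of ?B q x]
    by (simp add: dist_commute)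
  also have "\<dots> \<le> (1 - ?B / ?A) * ?B + ?B / ?A * ((1 - \<gamma>) * (?A + ?B))"
    using le by (intro add_left_mono mult_left_mono) (auto simp: dist_commute)
  also have "\<dots> = ?B * (2 - \<gamma>) - \<gamma> * ?B\<^sup>2 / ?A"
    using pos by (simp add: field_simps power2_eq_square)
  also have "\<dots> \<le> ?B * (2 - \<gamma>)"
    using \<gamma> by simp
  finally have 1: "dist (gpath q (Inl x) ?B) y \<le> ?B * (2 - \<gamma>)"
    by (simp add: dist_commute)
  have "dist (gpath q (Inl x) s) (gpath q (Inl y) s)
      \<le> s / ?B * dist (gpath q (Inl x) ?B) (gpath q (Inl y) ?B)"
    using le pos by (intro dist_gpath_shrink) auto
  also have "\<dots> \<le> s / ?B * (?B * (2 - \<gamma>))"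
    using 1 le by (intro mult_left_mono) auto
  also have "\<dots> = 2 * s * (1 - \<gamma> / 2)"
    using pos by (simp add: field_simps)
  finally show ?case .
next
  case (sym x y)
  from sym(1)[of x y] sym(2-) show ?case
    by (simp add: dist_commute add.commute)
qed

section \<open>Midpoints between a ray and a distant point\<close>

lemma continuous_on_gpath_Inl:
  fixes q :: "'a::busemann_space" and x :: "'b::metric_space \<Rightarrow> 'a"
  assumes "0 \<le> s" and x: "continuous_on S x" and far: "\<And>r. r \<in> S \<Longrightarrow> s \<le> dist q (x r)"
  shows "continuous_on S (\<lambda>r. gpath q (Inl (x r)) s)"
  unfolding continuous_on_iff
proof (intro ballI allI impI)
  fix r and e :: real assume r: "r \<in> S" and "e > 0"
  then have "e / 2 > 0" by simp
  with x r obtain d where d: "d > 0" "\<And>r'. r' \<in> S \<Longrightarrow> dist r' r < d \<Longrightarrow> dist (x r') (x r) < e / 2"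
    unfolding continuous_on_iff by metis
  have "dist (gpath q (Inl (x r')) s) (gpath q (Inl (x r)) s) < e"
    if "r' \<in> S" "dist r' r < d" for r'
    using dist_gpath_Inl_le[OF \<open>0 \<le> s\<close> far[OF that(1)] far[OF r]] d(2)[OF that] by linarith
  with d(1) show "\<exists>d>0. \<forall>r'\<in>S. dist r' r < d \<longrightarrow>
      dist (gpath q (Inl (x r')) s) (gpath q (Inl (x r)) s) < e"
    by blast
qed

text \<open>The midpoint of \<open>c r\<close> and \<open>z\<close> is seen from \<open>q\<close> in a direction that moves from that of
  \<open>z\<close> to that of \<open>c\<close> as \<open>r\<close> grows, so it can be stopped at distance 1 from \<open>c\<close>, unless
  already \<open>z\<close> is in a direction close to \<open>c\<close>.\<close>

lemma midpoint_at_unit_deviation: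
  fixes q z :: "'a::busemann_space" and c :: "real \<Rightarrow> 'a"
  assumes c: "is_ray c" "c 0 = q" and f: "convex_lipschitz f" "\<And>s. 0 \<le> s \<Longrightarrow> f (c s) = f q - s"
    and z: "f z \<le> f q + D" and K: "0 < K" and D: "0 \<le> D"
    and far: "4 * K + D \<le> dist q z"
  obtains r where "0 \<le> r" "(dist q z - D) / 4 \<le> dist q (geo (c r) z (1/2))"
    "dist (gpath q (Inl (geo (c r) z (1/2))) K) (c K) \<le> 1"
    "r = 0 \<or> dist (gpath q (Inl (geo (c r) z (1/2))) K) (c K) = 1"
proof -
  define m where "m r = geo (c r) z (1/2)" for r
  define T where "T = dist q z"
  define h where "h r = dist (gpath q (Inl (m r)) K) (c K)" for r
  have qc: "dist q (c r) = r" if "0 \<le> r" for r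
    using is_rayD[OF c(1), of 0 r] c(2) that by simp
  have fm: "f (m r) \<le> f q - (r - D) / 2" if "0 \<le> r" for r
    using convex_lipschitzD(2)[OF f(1), of "1/2" "c r" z] f(2)[OF that] z by (simp add: m_def field_simps)
  have m1: "(r - D) / 2 \<le> dist q (m r)" if "0 \<le> r" for r
    using convex_lipschitzD(1)[OF f(1), of q "m r"] fm[OF that] by linarith
  have m0: "dist q (m 0) = T / 2"
    using dist_geo_geo[of 0 "1/2" q z] c(2) by (simp add: m_def T_def)
  have "dist (m 0) (m r) \<le> r / 2" if "0 \<le> r" for r
    using dist_geo_le[of "1/2" "c 0" z "c r" z] qc[OF that] c(2) by (simp add: m_def)
  then have m2: "(T - r) / 2 \<le> dist q (m r)" if "0 \<le> r" for r
    using dist_triangle[of q "m 0" "m r"] m0 that by (force simp: dist_commute)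
  \<comment> \<open>The two lower bounds depend on \<open>r\<close> in opposite ways; their average
    is free of \<open>r\<close>, and \<open>far\<close> makes it at least \<open>K\<close>.\<close>
  have m_far: "(T - D) / 4 \<le> dist q (m r)" if "0 \<le> r" for r
    using add_mono[OF m1[OF that] m2[OF that]] by (simp add: field_simps)
  then have mK: "K \<le> dist q (m r)" if "0 \<le> r" for r
    using far that unfolding T_def[symmetric] by force
  have "dist (m r) (m r') \<le> dist r r'" if "r \<in> {0..}" "r' \<in> {0..}" for r r'
    using dist_geo_le[of "1/2" "c r" z "c r'" z] is_rayD[OF c(1), of r r'] that
    by (simp add: m_def dist_real_def)
  then have "1-lipschitz_on {0..} m"
    by (intro lipschitz_onI) auto
  then have "continuous_on {0..} m"
    by (rule lipschitz_on_continuous_on)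
  then have cont: "continuous_on {0..} h"
    unfolding h_def using mK K
    by (intro continuous_intros continuous_on_gpath_Inl) auto
  \<comment> \<open>For this \<open>r\<close>, \<open>?a\<close> equals \<open>K * T + K\<close>.
    The midpoints of \<open>c r\<close> with \<open>z\<close> and with \<open>q\<close> are at most
    \<open>T / 2\<close> apart, so the segments to them deviate by at most \<open>T\<close> at time
    \<open>?a\<close> and by at most \<open>T / (T + 1)\<close> at time \<open>K\<close>.\<close>
  have "h (2 * K * T + 2 * K + D) \<le> 1"
  proof -
    let ?r = "2 * K * T + 2 * K + D"
    let ?a = "(?r - D) / 2"
    have KT: "0 \<le> K * T"
      using K by (simp add: T_def)
    have r: "0 \<le> ?r" "K \<le> ?a" "0 < ?a" "?a \<le> ?r / 2"
      using K D KT by auto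
    have mid: "c (?r / 2) = geo (c ?r) q (1/2)"
      using ray_geo[OF c(1), of "1/2" ?r] geo_reverse[of "1/2" "c ?r" q] c(2) r by simp
    have "dist (m ?r) (c (?r / 2)) \<le> T / 2"
      using dist_geo_le[of "1/2" "c ?r" z "c ?r" q]
      unfolding mid m_def by (simp add: T_def dist_commute)
    moreover have far': "?a \<le> dist q (m ?r)" "?a \<le> dist q (c (?r / 2))"
      using m1[OF r(1)] qc[of "?r / 2"] r by auto
    ultimately have "dist (gpath q (Inl (m ?r)) ?a) (gpath q (Inl (c (?r / 2))) ?a) \<le> T"
      using dist_gpath_Inl_le[of ?a q "m ?r" "c (?r / 2)"] r by linarith
    then have "K / ?a * dist (gpath q (Inl (m ?r)) ?a) (gpath q (Inl (c (?r / 2))) ?a) \<le> K / ?a * T"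
      using K r by (intro mult_left_mono) auto
    moreover have "gpath q (Inl (c (?r / 2))) K = c K"
      using ray_gpath[OF c(1), of K "?r / 2"] c(2) r K by simp
    ultimately have "h ?r \<le> K / ?a * T"
      using dist_gpath_shrink[of K ?a q "m ?r" "c (?r / 2)"] far' r K by (simp add: h_def)
    also have "K / ?a * T \<le> 1"
      using K KT r by (simp add: field_simps)
    finally show ?thesis .
  qed
  moreover have "0 \<le> 2 * K * T + 2 * K + D"
    using K D by (simp add: T_def)
  moreover have "continuous_on {0..2 * K * T + 2 * K + D} h"
    using cont by (rule continuous_on_subset) auto
  \<comment> \<open>If \<open>h\<close> starts above 1, it attains 1 by the intermediate value
    theorem. The exact value places the point at time \<open>K\<close> in the set where
    \<open>descent_gap\<close> gives its bound.\<close>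
  ultimately have "\<exists>r\<ge>0. h r \<le> 1 \<and> (r = 0 \<or> h r = 1)"
    using IVT2'[of h "2 * K * T + 2 * K + D" 1 0] by (cases "h 0 \<le> 1") auto
  then show ?thesis
    using that m_far by (auto simp: h_def m_def T_def)
qed

section \<open>Bounds for the limit delta\<close>

lemma monotone_limit_le:
  fixes h :: "real \<Rightarrow> real"
  assumes mono: "\<And>s t. 0 < s \<Longrightarrow> s \<le> t \<Longrightarrow> h s \<le> h t" and le: "\<And>t. 0 < t \<Longrightarrow> h t \<le> b"
  shows "Lim at_top h \<le> b"
proof -
  define l where "l = (SUP t\<in>{0<..}. h t)"
  have bdd: "bdd_above (h ` {0<..})"
    using le by (auto simp: bdd_above_def)
  \<comment> \<open>\<open>Lim\<close> is meaningful only once a limit exists; monotonicity provides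
    it as the supremum over positive times.\<close>
  have "(h \<longlongrightarrow> l) at_top"
  proof (rule increasing_tendsto)
    show "\<forall>\<^sub>F t in at_top. h t \<le> l"
      using eventually_gt_at_top[of 0]
      by eventually_elim (auto simp: l_def intro!: cSUP_upper bdd)
    fix x assume "x < l"
    then obtain s where s: "0 < s" "x < h s"
      unfolding l_def using less_cSUP_iff[OF _ bdd] by auto
    show "\<forall>\<^sub>F t in at_top. x < h t"
      using eventually_ge_at_top[of s]
      by eventually_elim (use mono[of s] s in force)
  qed
  moreover have "l \<le> b"
    unfolding l_def by (rule cSUP_least) (use le in auto)
  ultimately show ?thesis
    using tendsto_Lim[of at_top h l] by simp
qed

lemma delta_ray_end_le:
  fixes c d :: "real \<Rightarrow> 'a::busemann_space"
  assumes c: "is_ray c" "c 0 = q" and d: "is_ray d" "d 0 = q"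
    and le: "\<And>s. 0 < s \<Longrightarrow> dist (c s) (d s) \<le> 2 * s * b"
  shows "delta q (ray_end c) (ray_end d) \<le> b"
  unfolding delta_def
proof (rule monotone_limit_le)
  have eq: "ray_from q (ray_end c) s = c s" "ray_from q (ray_end d) s = d s" if "0 \<le> s" for s
    using ray_from_ray_end[OF c(1) that] ray_from_ray_end[OF d(1) that] c(2) d(2) by auto
  fix t :: real assume t: "0 < t"
  show "dist (ray_from q (ray_end c) t) (ray_from q (ray_end d) t) / (2 * t) \<le> b"
    using le[OF t] t eq by (simp add: field_simps)
next
  have eq: "ray_from q (ray_end c) s = c s" "ray_from q (ray_end d) s = d s" if "0 \<le> s" for s
    using ray_from_ray_end[OF c(1) that] ray_from_ray_end[OF d(1) that] c(2) d(2) by auto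
  fix s t :: real assume st: "0 < s" "s \<le> t"
  then show "dist (ray_from q (ray_end c) s) (ray_from q (ray_end d) s) / (2 * s)
      \<le> dist (ray_from q (ray_end c) t) (ray_from q (ray_end d) t) / (2 * t)"
    using dist_rays_shrink[OF c(1) d(1), of s t] c(2) d(2) eq by (simp add: field_simps)
qed

section \<open>Linear loss away from steepest descent, and limits of segments\<close>

context proper_busemann
begin

text \<open>By \<open>steepest_descent_unique\<close>, a point at distance \<open>K\<close> from
  \<open>p\<close> other than \<open>c K\<close> descends by less than \<open>K\<close>. Those at
  distance 1 from \<open>c K\<close> form a compact set, so, if there are any, the loss has a
  positive minimum.\<close>

lemma descent_gap:
  assumes f: "convex_lipschitz f" and c: "is_ray c" "c 0 = p" "f (c K) = f p - K" and K: "0 < K"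
  obtains g where "0 < g" "\<And>w. dist p w = K \<Longrightarrow> dist w (c K) = 1 \<Longrightarrow> f p - K + g \<le> f w"
proof -
  define S where "S = {w \<in> cball p K. dist p w = K \<and> dist w (c K) = 1}"
  have "compact S"
  proof -
    have "S = cball p K \<inter> ({w. dist p w = K} \<inter> {w. dist w (c K) = 1})"
      by (auto simp: S_def)
    moreover have "closed ({w. dist p w = K} \<inter> {w. dist w (c K) = 1})"
      by (intro closed_Int closed_Collect_eq continuous_intros)
    ultimately show ?thesis
      using compact_Int_closed[OF proper] by metis
  qed
  have pK: "dist p (c K) = K"
    using is_rayD[OF c(1), of 0 K] c(2) K by simp
  have pos: "f p - K < f w" if "w \<in> S" for w
  proof -
    have "w \<noteq> c K" "dist p w = K"
      using that by (auto simp: S_def)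
    then have "f w \<noteq> f p - K"
      using steepest_descent_unique[OF f, of p w K "c K"] c(3) pK by auto
    moreover have "f p - K \<le> f w"
      using convex_lipschitzD(1)[OF f, of p w] \<open>dist p w = K\<close> by linarith
    ultimately show ?thesis by simp
  qed
  have "\<exists>g>0. \<forall>w\<in>S. f p - K + g \<le> f w"
  proof (cases "S = {}")
    case True
    then show ?thesis by (intro exI[of _ 1]) simp
  next
    case False
    then obtain v where v: "v \<in> S" "\<And>w. w \<in> S \<Longrightarrow> f v \<le> f w"
      using continuous_attains_inf[OF \<open>compact S\<close> _ convex_lipschitz_continuous[OF f]] by blast
    then show ?thesis
      using pos[OF v(1)] by (intro exI[of _ "f v - (f p - K)"]) auto
  qed
  with that show ?thesis
    by (auto simp: S_def)
qed

text \<open>When the deviation is exactly 1, the descent at time \<open>K\<close> on the segment to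
  the midpoint is at most \<open>K * (1 - \<gamma>)\<close>. By convexity the average descent per
  length up to the midpoint is no larger, whereas the value of \<open>f\<close> at the midpoint
  forces a descent of at least \<open>(r - D) / 2\<close>.\<close>

lemma midpoint_gain:
  assumes c: "is_ray c" "c 0 = p" and f: "convex_lipschitz f" "\<And>s. 0 \<le> s \<Longrightarrow> f (c s) = f p - s"
    and z: "f z \<le> f p + D" and K: "0 < K" and D: "0 \<le> D" and far: "4 * K + D \<le> dist p z"
    and gap: "\<And>w. dist p w = K \<Longrightarrow> dist w (c K) = 1 \<Longrightarrow> f p - K + K * \<gamma> \<le> f w" and \<gamma>: "\<gamma> \<le> 1"
  obtains r where "0 \<le> r" "(dist p z - D) / 4 \<le> dist p (geo (c r) z (1/2))"
    "dist (gpath p (Inl (geo (c r) z (1/2))) K) (c K) \<le> 1"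
    "(r - D) / 2 \<le> (1 - \<gamma>) * dist p (geo (c r) z (1/2))"
proof -
  obtain r where r: "0 \<le> r" "(dist p z - D) / 4 \<le> dist p (geo (c r) z (1/2))"
      "dist (gpath p (Inl (geo (c r) z (1/2))) K) (c K) \<le> 1"
      "r = 0 \<or> dist (gpath p (Inl (geo (c r) z (1/2))) K) (c K) = 1"
    by (rule midpoint_at_unit_deviation[OF c f z K D far])
  define x where "x = geo (c r) z (1/2)"
  let ?w = "gpath p (Inl x) K"
  have far: "K \<le> dist p x"
    using r(2) far by (simp add: x_def)
  have "(r - D) / 2 \<le> (1 - \<gamma>) * dist p x"
  \<comment> \<open>For \<open>r = 0\<close> the deviation may be smaller than 1, but then the
    left-hand side is at most 0.\<close>
  proof (cases "r = 0")
    case True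
    have "0 \<le> (1 - \<gamma>) * dist p x"
      using \<gamma> by simp
    with True D show ?thesis by simp
  next
    case False
    have "f x \<le> f p - (r - D) / 2"
      using convex_lipschitzD(2)[OF f(1), of "1/2" "c r" z] f(2)[OF r(1)] z
      by (simp add: x_def field_simps)
    moreover have "f p - K + K * \<gamma> \<le> f ?w"
    proof (rule gap)
      show "dist p ?w = K"
        using dist_base_gpath_Inl[of K p x] far K by simp
      show "dist ?w (c K) = 1"
        using r(4) False by (simp add: x_def)
    qed
    moreover have "f ?w \<le> (1 - K / dist p x) * f p + K / dist p x * f x"
    proof -
      have u: "0 \<le> K / dist p x" "K / dist p x \<le> 1"
        using far K by (auto simp: divide_le_eq_1)
      have "?w = geo p x (K / dist p x)"
        using far K by (intro gpath_Inl_geo) auto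
      with convex_lipschitzD(2)[OF f(1) u] show ?thesis
        by metis
    qed
    ultimately have "f p - K + K * \<gamma> \<le> (1 - K / dist p x) * f p + K / dist p x * (f p - (r - D) / 2)"
      using far K by (smt (verit) divide_nonneg_nonneg mult_left_mono)
    also have "\<dots> = f p - K / dist p x * ((r - D) / 2)"
      by (simp add: algebra_simps)
    finally have "K * ((r - D) / 2 / dist p x) \<le> K * (1 - \<gamma>)"
      by (simp add: algebra_simps)
    then have "(r - D) / 2 / dist p x \<le> 1 - \<gamma>"
      using K by (simp only: mult_le_cancel_left_pos)
    moreover have "0 < dist p x"
      using far K by linarith
    ultimately show ?thesis
      by (simp only: pos_divide_le_eq)
  qed
  with r that show ?thesis
    by (simp add: x_def)
qed

text \<open>A diagonal subsequence, common to both sequences, gives convergence at all integer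
  times. Convergence at time \<open>m\<close> forces it at earlier times, because by
  \<open>dist_gpath_Inl_le\<close> a segment depends on its endpoint in a Lipschitz way.\<close>

lemma limit_rays:
  fixes x y :: "nat \<Rightarrow> 'a"
  assumes x: "filterlim (\<lambda>n. dist p (x n)) at_top sequentially"
    and y: "filterlim (\<lambda>n. dist p (y n)) at_top sequentially"
  obtains r c d where "strict_mono r" "is_ray c" "c 0 = p" "is_ray d" "d 0 = p"
    "\<And>s. 0 \<le> s \<Longrightarrow> (\<lambda>n. gpath p (Inl (x (r n))) s) \<longlonglongrightarrow> c s"
    "\<And>s. 0 \<le> s \<Longrightarrow> (\<lambda>n. gpath p (Inl (y (r n))) s) \<longlonglongrightarrow> d s"
proof -
  let ?P = "\<lambda>m r. convergent (\<lambda>n. gpath p (Inl (x (r n))) (real m)) \<and>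
      convergent (\<lambda>n. gpath p (Inl (y (r n))) (real m))"
  have sub: "\<exists>r. strict_mono r \<and> convergent (\<lambda>n. gpath p (Inl (v (r n))) (real m))"
    for v :: "nat \<Rightarrow> 'a" and m
  proof -
    have "dist p (gpath p (Inl (v n)) (real m)) \<le> real m" for n
      using dist_base_gpath_Inl[of "real m" p "v n"] by simp
    then obtain r l where "strict_mono r" "((\<lambda>n. gpath p (Inl (v n)) (real m)) \<circ> r) \<longlonglongrightarrow> l"
      using bounded_subseq[of "\<lambda>n. gpath p (Inl (v n)) (real m)" "real m"] by blast
    then show ?thesis
      unfolding convergent_def o_def by blast
  qed
  interpret subseqs ?P
  proof
    fix m :: nat and s :: "nat \<Rightarrow> nat"
    obtain r1 where r1: "strict_mono r1" "convergent (\<lambda>n. gpath p (Inl (x (s (r1 n)))) (real m))"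
      using sub[of "\<lambda>n. x (s n)" m] by blast
    obtain r2 where r2: "strict_mono r2" "convergent (\<lambda>n. gpath p (Inl (y (s (r1 (r2 n))))) (real m))"
      using sub[of "\<lambda>n. y (s (r1 n))" m] by blast
    have "convergent (\<lambda>n. gpath p (Inl (x (s (r1 (r2 n))))) (real m))"
      using convergent_subseq_convergent[OF r1(2) r2(1)] by (simp add: o_def)
    with r1(1) r2 show "\<exists>r. strict_mono r \<and> ?P m (s \<circ> r)"
      by (intro exI[of _ "r1 \<circ> r2"]) (auto simp: o_def strict_mono_def)
  qed
  \<comment> \<open>Only the tail of \<open>diagseq\<close> from \<open>Suc m\<close> on is a
    subsequence of the one extracted for time \<open>m\<close>; this suffices for
    convergence.\<close>
  have shift: "diagseq \<circ> (+) (Suc m) = (\<lambda>n. diagseq (n + Suc m))" for m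
    by (simp add: fun_eq_iff add.commute)
  have "?P m (diagseq \<circ> (+) (Suc m))" for m
  proof (rule diagseq_holds)
    fix m and r s :: "nat \<Rightarrow> nat"
    assume "strict_mono r" "?P m s"
    then show "?P m (s \<circ> r)"
      using convergent_subseq_convergent[of "\<lambda>n. gpath p (Inl (x (s n))) (real m)" r]
        convergent_subseq_convergent[of "\<lambda>n. gpath p (Inl (y (s n))) (real m)" r]
      by (simp add: o_def)
  qed
  then have diag: "?P m diagseq" for m
    using convergent_ignore_initial_segment[of "\<lambda>n. gpath p (Inl (x (diagseq n))) (real m)" "Suc m"]
      convergent_ignore_initial_segment[of "\<lambda>n. gpath p (Inl (y (diagseq n))) (real m)" "Suc m"]
    by (simp only: shift)
  have lim: "\<exists>l. (\<lambda>n. gpath p (Inl (v (diagseq n))) s) \<longlonglongrightarrow> l"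
    if v: "filterlim (\<lambda>n. dist p (v n)) at_top sequentially"
      and conv: "\<And>m. convergent (\<lambda>n. gpath p (Inl (v (diagseq n))) (real m))"
      and s: "0 \<le> s" for v s
  proof -
    obtain m where m: "s \<le> real m"
      using real_arch_simple by blast
    let ?u = "\<lambda>n. gpath p (Inl (v (diagseq n))) (real m)"
    obtain u where u: "?u \<longlonglongrightarrow> u"
      using conv unfolding convergent_def by blast
    have "\<forall>\<^sub>F n in sequentially. real m \<le> dist p (v n)"
      using v by (simp add: filterlim_at_top)
    from eventually_subseq[OF subseq_diagseq this]
    have far: "\<forall>\<^sub>F n in sequentially. real m \<le> dist p (v (diagseq n))" .
    have eq: "dist p (?u n) = real m \<and> gpath p (Inl (?u n)) s = gpath p (Inl (v (diagseq n))) s"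
      if "real m \<le> dist p (v (diagseq n))" for n
      using that gpath_gpath_Inl[OF s m that] dist_base_gpath_Inl[of "real m" p "v (diagseq n)"]
      by simp
    have "(\<lambda>n. dist p (?u n)) \<longlonglongrightarrow> dist p u"
      by (intro tendsto_intros u)
    moreover have "\<forall>\<^sub>F n in sequentially. dist p (?u n) = real m"
      using far by eventually_elim (use eq in simp)
    ultimately have "(\<lambda>n::nat. real m) \<longlonglongrightarrow> dist p u"
      by (rule Lim_transform_eventually)
    then have pu: "dist p u = real m"
      by (simp add: LIMSEQ_const_iff)
    have "(\<lambda>n. 2 * dist (?u n) u) \<longlonglongrightarrow> 2 * dist u u"
      by (intro tendsto_intros u)
    then have "(\<lambda>n. 2 * dist (?u n) u) \<longlonglongrightarrow> 0"
      by simp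
    moreover have "\<forall>\<^sub>F n in sequentially. norm (dist (gpath p (Inl (v (diagseq n))) s) (gpath p (Inl u) s))
        \<le> 2 * dist (?u n) u"
      using far
    proof eventually_elim
      case (elim n)
      then show ?case
        using dist_gpath_Inl_le[of s p "?u n" u] eq[OF elim] pu s m by simp
    qed
    ultimately have "(\<lambda>n. dist (gpath p (Inl (v (diagseq n))) s) (gpath p (Inl u) s)) \<longlonglongrightarrow> 0"
      by (rule Lim_null_comparison[rotated])
    then show ?thesis
      using tendsto_dist_iff by blast
  qed
  obtain c where c: "\<And>s. 0 \<le> s \<Longrightarrow> (\<lambda>n. gpath p (Inl (x (diagseq n))) s) \<longlonglongrightarrow> c s"
  proof -
    have "\<forall>s. \<exists>l. 0 \<le> s \<longrightarrow> (\<lambda>n. gpath p (Inl (x (diagseq n))) s) \<longlonglongrightarrow> l"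
      using lim[OF x conjunct1[OF diag]] by blast
    from choice[OF this] that show thesis by blast
  qed
  obtain d where d: "\<And>s. 0 \<le> s \<Longrightarrow> (\<lambda>n. gpath p (Inl (y (diagseq n))) s) \<longlonglongrightarrow> d s"
  proof -
    have "\<forall>s. \<exists>l. 0 \<le> s \<longrightarrow> (\<lambda>n. gpath p (Inl (y (diagseq n))) s) \<longlonglongrightarrow> l"
      using lim[OF y conjunct2[OF diag]] by blast
    from choice[OF this] that show thesis by blast
  qed
  have far: "filterlim (\<lambda>n. dist p (v (diagseq n))) at_top sequentially"
    if "filterlim (\<lambda>n. dist p (v n)) at_top sequentially" for v :: "nat \<Rightarrow> 'a"
    using filterlim_compose[OF that filterlim_subseq[OF subseq_diagseq]] .
  show ?thesis
    by (rule that[OF subseq_diagseq limit_ray[OF far[OF x] c] limit_ray[OF far[OF y] d] c d])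
qed

end

section \<open>From bounds along a ray to \<zeta> to ideal points near \<xi> and \<eta>\<close>

lemma Td_le_half_piD:
  assumes "Td_le_half_pi (fclass f) \<zeta>"
  obtains c where "is_ray c" "ray_end c = \<zeta>" "\<And>t. 0 \<le> t \<Longrightarrow> f (c t) \<le> f (c 0)"
proof -
  obtain g c where g: "g \<in> fclass f" "is_ray c" "ray_end c = \<zeta>" "antimono_on {0..} (g \<circ> c)"
    using assms unfolding Td_le_half_pi_def by blast
  obtain k where k: "\<And>x. g x = f x + k"
    using g(1) unfolding fclass_iff by blast
  have "f (c t) \<le> f (c 0)" if "0 \<le> t" for t
    using monotone_onD[OF g(4), of 0 t] that by (simp add: k)
  with g that show ?thesis by blast
qed

text \<open>Points of the two rays are matched at bounded distance, over which a 1-Lipschitz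
  function changes boundedly. This yields bounds on a common ray when the two relations to \<zeta>
  are witnessed by different rays.\<close>

lemma bounded_above_on_asymptotic_ray:
  assumes f: "convex_lipschitz f" and cd: "(c, d) \<in> asymptotic"
    and le: "\<And>t. 0 \<le> t \<Longrightarrow> f (d t) \<le> b"
  obtains D where "\<And>t. 0 \<le> t \<Longrightarrow> f (c t) \<le> b + D"
proof -
  obtain D where D: "\<And>t. 0 \<le> t \<Longrightarrow> \<exists>s\<ge>0. dist (c t) (d s) \<le> D"
    using asymptotic_bounded[OF cd] by blast
  have "f (c t) \<le> b + D" if t: "0 \<le> t" for t
  proof -
    obtain s where "0 \<le> s" "dist (c t) (d s) \<le> D"
      using D[OF t] by blast
    with le[of s] convex_lipschitzD(1)[OF f, of "c t" "d s"] show ?thesis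
      by linarith
  qed
  with that show ?thesis by blast
qed

context proper_busemann
begin

lemma Td_le_pi_if_bounded_on_ray:
  assumes \<Phi>: "horofunction \<Phi>" and \<Psi>: "horofunction \<Psi>"
    and \<xi>: "pi_hg p (fclass \<Phi>) = Inr \<xi>" and \<eta>: "pi_hg p (fclass \<Psi>) = Inr \<eta>"
    and c: "is_ray c" and D: "0 \<le> D"
    and \<Phi>_le: "\<And>t. 0 \<le> t \<Longrightarrow> \<Phi> (c t) \<le> \<Phi> p + D"
    and \<Psi>_le: "\<And>t. 0 \<le> t \<Longrightarrow> \<Psi> (c t) \<le> \<Psi> p + D"
  shows "Td_le_pi p \<xi> \<eta>"
  unfolding Td_le_pi_def
proof (intro allI impI)
  fix U V
  assume U: "openin (cone_topology p) U" "Inr \<xi> \<in> U" and V: "openin (cone_topology p) V" "Inr \<eta> \<in> V"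
  define a where "a = ray_from p \<xi>"
  define b where "b = ray_from p \<eta>"
  have a: "is_ray a" "a 0 = p" "\<And>s. 0 \<le> s \<Longrightarrow> \<Phi> (a s) = \<Phi> p - s"
    using pi_hg_ray[OF \<Phi> \<xi>] by (simp_all add: a_def)
  have b: "is_ray b" "b 0 = p" "\<And>s. 0 \<le> s \<Longrightarrow> \<Psi> (b s) = \<Psi> p - s"
    using pi_hg_ray[OF \<Psi> \<eta>] by (simp_all add: b_def)
  have cl: "convex_lipschitz \<Phi>" "convex_lipschitz \<Psi>"
    using \<Phi> \<Psi> by (auto simp: horofunction_def hboundary_def intro: convex_lipschitz_hcompact)
  obtain K1 where K1: "\<And>K d. K1 \<le> K \<Longrightarrow> is_ray d \<Longrightarrow> d 0 = p \<Longrightarrow> dist (d K) (a K) \<le> 1 \<Longrightarrow>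
      Inr (ray_end d) \<in> U"
    using cone_neighbourhood_rays[OF U] a unfolding a_def by metis
  obtain K2 where K2: "\<And>K d. K2 \<le> K \<Longrightarrow> is_ray d \<Longrightarrow> d 0 = p \<Longrightarrow> dist (d K) (b K) \<le> 1 \<Longrightarrow>
      Inr (ray_end d) \<in> V"
    using cone_neighbourhood_rays[OF V] b unfolding b_def by metis
  \<comment> \<open>Large enough for both neighbourhoods, and at least 1 so as to be
    positive.\<close>
  define K where "K = max 1 (max K1 K2)"
  have K: "0 < K" "K1 \<le> K" "K2 \<le> K"
    by (auto simp: K_def)
  obtain g1 where g1: "0 < g1" "\<And>w. dist p w = K \<Longrightarrow> dist w (a K) = 1 \<Longrightarrow> \<Phi> p - K + g1 \<le> \<Phi> w"
    using descent_gap[OF cl(1) a(1,2) _ K(1)] a(3)[of K] K(1) by auto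
  obtain g2 where g2: "0 < g2" "\<And>w. dist p w = K \<Longrightarrow> dist w (b K) = 1 \<Longrightarrow> \<Psi> p - K + g2 \<le> \<Psi> w"
    using descent_gap[OF cl(2) b(1,2) _ K(1)] b(3)[of K] K(1) by auto
  \<comment> \<open>The smaller gap per unit length works for both functions; the bound by 1 is a
    hypothesis of \<open>midpoint_gain\<close>.\<close>
  define \<gamma> where "\<gamma> = min 1 (min (g1 / K) (g2 / K))"
  have \<gamma>: "0 < \<gamma>" "\<gamma> \<le> 1"
    using g1(1) g2(1) K(1) by (auto simp: \<gamma>_def)
  have "\<gamma> \<le> g1 / K" "\<gamma> \<le> g2 / K"
    by (auto simp: \<gamma>_def)
  then have "K * \<gamma> \<le> g1" "K * \<gamma> \<le> g2"
    using K(1) by (simp_all add: field_simps)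
  then have gap: "\<Phi> p - K + K * \<gamma> \<le> \<Phi> w" if "dist p w = K" "dist w (a K) = 1" for w
    using g1(2)[OF that] by linarith
  have gap': "\<Psi> p - K + K * \<gamma> \<le> \<Psi> w" if "dist p w = K" "dist w (b K) = 1" for w
    using g2(2)[OF that] \<open>K * \<gamma> \<le> g2\<close> by linarith
  \<comment> \<open>The summand \<open>dist p (c 0)\<close> compensates for the start of
    \<open>c\<close> away from \<open>p\<close>. The distance from \<open>p\<close> then meets the
    demand of \<open>midpoint_gain\<close> and grows with \<open>n\<close>.\<close>
  define z where "z n = c (real n + 4 * K + D + dist p (c 0))" for n
  have z: "real n + 4 * K + D \<le> dist p (z n)" for n
  proof -
    have "0 \<le> real n + 4 * K + D + dist p (c 0)"
      using K(1) D by simp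
    from is_rayD[OF c order_refl this] abs_of_nonneg[OF this]
    have "dist (c 0) (z n) = real n + 4 * K + D + dist p (c 0)"
      by (simp only: z_def diff_0 abs_minus_cancel)
    then show ?thesis
      using dist_triangle[of "c 0" "z n" p] by (simp add: dist_commute)
  qed
  have z_far: "4 * K + D \<le> dist p (z n)" for n
    using z[of n] by linarith
  have z_le: "\<Phi> (z n) \<le> \<Phi> p + D" "\<Psi> (z n) \<le> \<Psi> p + D" for n
    unfolding z_def using K(1) D by (intro \<Phi>_le \<Psi>_le; simp)+
  have "\<exists>r\<ge>0. (dist p (z n) - D) / 4 \<le> dist p (geo (a r) (z n) (1/2)) \<and>
      dist (gpath p (Inl (geo (a r) (z n) (1/2))) K) (a K) \<le> 1 \<and>
      (r - D) / 2 \<le> (1 - \<gamma>) * dist p (geo (a r) (z n) (1/2))" for n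
    by (rule midpoint_gain[OF a(1,2) cl(1) a(3) z_le(1) K(1) D z_far gap \<gamma>(2)]) blast+
  then obtain r where r: "\<And>n. 0 \<le> r n"
      "\<And>n. (dist p (z n) - D) / 4 \<le> dist p (geo (a (r n)) (z n) (1/2))"
      "\<And>n. dist (gpath p (Inl (geo (a (r n)) (z n) (1/2))) K) (a K) \<le> 1"
      "\<And>n. (r n - D) / 2 \<le> (1 - \<gamma>) * dist p (geo (a (r n)) (z n) (1/2))"
    by metis
  have "\<exists>r\<ge>0. (dist p (z n) - D) / 4 \<le> dist p (geo (b r) (z n) (1/2)) \<and>
      dist (gpath p (Inl (geo (b r) (z n) (1/2))) K) (b K) \<le> 1 \<and>
      (r - D) / 2 \<le> (1 - \<gamma>) * dist p (geo (b r) (z n) (1/2))" for n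
    by (rule midpoint_gain[OF b(1,2) cl(2) b(3) z_le(2) K(1) D z_far gap' \<gamma>(2)]) blast+
  then obtain r' where r': "\<And>n. 0 \<le> r' n"
      "\<And>n. (dist p (z n) - D) / 4 \<le> dist p (geo (b (r' n)) (z n) (1/2))"
      "\<And>n. dist (gpath p (Inl (geo (b (r' n)) (z n) (1/2))) K) (b K) \<le> 1"
      "\<And>n. (r' n - D) / 2 \<le> (1 - \<gamma>) * dist p (geo (b (r' n)) (z n) (1/2))"
    by metis
  define x where "x n = geo (a (r n)) (z n) (1/2)" for n
  define y where "y n = geo (b (r' n)) (z n) (1/2)" for n
  have x_far: "real n / 4 \<le> dist p (x n)" and y_far: "real n / 4 \<le> dist p (y n)" for n
    using r(2)[of n] r'(2)[of n] z[of n] K(1) by (simp_all add: x_def y_def)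
  have tends: "filterlim (\<lambda>n. dist p (v n)) at_top sequentially"
    if "\<And>n. real n / 4 \<le> dist p (v n)" for v :: "nat \<Rightarrow> 'a"
    unfolding filterlim_at_top
  proof
    fix Z :: real
    show "\<forall>\<^sub>F n in sequentially. Z \<le> dist p (v n)"
      using eventually_ge_at_top[of "nat \<lceil>4 * Z\<rceil>"]
    proof eventually_elim
      case (elim n)
      then have "4 * Z \<le> real n" by linarith
      with that[of n] show ?case by linarith
    qed
  qed
  \<comment> \<open>The midpoints share the endpoint \<open>z n\<close>, so convexity halves the
    distance between the points on the two rays, which is at most \<open>r n + r' n\<close>.\<close>
  have xy: "dist (x n) (y n) \<le> (1 - \<gamma>) * (dist p (x n) + dist p (y n)) + D" for n
  proof -
    have "dist (x n) (y n) \<le> dist (a (r n)) (b (r' n)) / 2"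
      using dist_geo_le[of "1/2" "a (r n)" "z n" "b (r' n)" "z n"] by (simp add: x_def y_def)
    also have "dist (a (r n)) (b (r' n)) \<le> r n + r' n"
      using dist_triangle[of "a (r n)" "b (r' n)" p] is_rayD[OF a(1), of "r n" 0]
        is_rayD[OF b(1), of 0 "r' n"] a(2) b(2) r(1)[of n] r'(1)[of n] by simp
    finally have "dist (x n) (y n) \<le> (r n + r' n) / 2"
      by simp
    also have "\<dots> = (r n - D) / 2 + (r' n - D) / 2 + D"
      by (simp add: field_simps)
    also have "\<dots> \<le> (1 - \<gamma>) * dist p (x n) + (1 - \<gamma>) * dist p (y n) + D"
      using r(4)[of n] r'(4)[of n] unfolding x_def y_def by (intro add_mono order_refl)
    finally show ?thesis
      by (simp only: distrib_left)
  qed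
  \<comment> \<open>Half of \<gamma> is spent on absorbing \<open>D\<close>, which is possible
    because the midpoints escape to infinity.\<close>
  have xy': "\<forall>\<^sub>F n in sequentially.
      dist (x n) (y n) \<le> (1 - \<gamma> / 2) * (dist p (x n) + dist p (y n))"
  proof -
    have "\<forall>\<^sub>F n in sequentially. 2 * D / \<gamma> \<le> dist p (x n)"
      using tends[OF x_far] by (simp add: filterlim_at_top)
    then show ?thesis
    proof eventually_elim
      case (elim n)
      have "D \<le> \<gamma> / 2 * dist p (x n)"
        using elim \<gamma>(1) by (simp add: field_simps)
      also have "\<dots> \<le> \<gamma> / 2 * (dist p (x n) + dist p (y n))"
        using \<gamma>(1) by (intro mult_left_mono) auto
      finally show ?case
        using xy[of n] by (simp add: algebra_simps)
    qed
  qed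
  obtain l d e where l: "strict_mono l" and d: "is_ray d" "d 0 = p" and e: "is_ray e" "e 0 = p"
    and d_lim: "\<And>s. 0 \<le> s \<Longrightarrow> (\<lambda>n. gpath p (Inl (x (l n))) s) \<longlonglongrightarrow> d s"
    and e_lim: "\<And>s. 0 \<le> s \<Longrightarrow> (\<lambda>n. gpath p (Inl (y (l n))) s) \<longlonglongrightarrow> e s"
    by (rule limit_rays[OF tends[OF x_far] tends[OF y_far]]) (rule that; assumption)
  \<comment> \<open>\<open>dist_gpath_opposite\<close>, applied with \<open>\<gamma> / 2\<close>,
    halves the deficit once more.\<close>
  have "dist (d s) (e s) \<le> 2 * s * (1 - \<gamma> / 4)" if s: "0 < s" for s
  proof -
    have lim: "(\<lambda>n. dist (gpath p (Inl (x (l n))) s) (gpath p (Inl (y (l n))) s))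
        \<longlonglongrightarrow> dist (d s) (e s)"
      using s by (intro tendsto_dist d_lim e_lim) auto
    have "\<forall>\<^sub>F n in sequentially. s \<le> dist p (x n)" "\<forall>\<^sub>F n in sequentially. s \<le> dist p (y n)"
      using tends[OF x_far] tends[OF y_far] by (auto simp: filterlim_at_top)
    with xy' have "\<forall>\<^sub>F n in sequentially.
        dist (gpath p (Inl (x n)) s) (gpath p (Inl (y n)) s) \<le> 2 * s * (1 - \<gamma> / 4)"
    proof eventually_elim
      case (elim n)
      then show ?case
        using dist_gpath_opposite[of s p "x n" "y n" "\<gamma> / 2"] s \<gamma>(1) by simp
    qed
    from eventually_subseq[OF l this] show ?thesis
      by (intro tendsto_upperbound[OF lim]) auto
  qed
  then have "delta p (ray_end d) (ray_end e) \<le> 1 - \<gamma> / 4"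
    using d e by (intro delta_ray_end_le) auto
  then have "Td_less_pi p (ray_end d) (ray_end e)"
    using \<gamma>(1) by (simp add: Td_less_pi_def)
  moreover have "dist (d K) (a K) \<le> 1"
  proof (rule tendsto_upperbound)
    show "(\<lambda>n. dist (gpath p (Inl (x (l n))) K) (a K)) \<longlonglongrightarrow> dist (d K) (a K)"
      using K(1) by (intro tendsto_dist d_lim tendsto_const) auto
  qed (use r(3) in \<open>auto simp: x_def\<close>)
  then have "Inr (ray_end d) \<in> U"
    using K1 K(2) d by blast
  moreover have "dist (e K) (b K) \<le> 1"
  proof (rule tendsto_upperbound)
    show "(\<lambda>n. dist (gpath p (Inl (y (l n))) K) (b K)) \<longlonglongrightarrow> dist (e K) (b K)"
      using K(1) by (intro tendsto_dist e_lim tendsto_const) auto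
  qed (use r'(3) in \<open>auto simp: y_def\<close>)
  then have "Inr (ray_end e) \<in> V"
    using K2 K(3) e by blast
  ultimately show "\<exists>\<xi>'\<in>gboundary. \<exists>\<eta>'\<in>gboundary. Inr \<xi>' \<in> U \<and> Inr \<eta>' \<in> V \<and> Td_less_pi p \<xi>' \<eta>'"
    using ray_end_gboundary d(1) e(1) by blast
qed

end

theorem theorem4p2:
  fixes p :: "'a::busemann_space"
    and \<Phi> \<Psi> :: "'a \<Rightarrow> real"
    and \<xi> \<eta> \<zeta> :: "(real \<Rightarrow> 'a) set"
  assumes proper: "\<And>(x::'a) r. compact (cball x r)"
    and noncompact: "\<not> compact (UNIV :: 'a set)"
    and \<Phi>: "horofunction \<Phi>"
    and \<Psi>: "horofunction \<Psi>"
    and \<zeta>: "\<zeta> \<in> gboundary"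
    and Td_\<Phi>: "Td_le_half_pi (fclass \<Phi>) \<zeta>"
    and Td_\<Psi>: "Td_le_half_pi (fclass \<Psi>) \<zeta>"
    and \<xi>: "pi_hg p (fclass \<Phi>) = Inr \<xi>"
    and \<eta>: "pi_hg p (fclass \<Psi>) = Inr \<eta>"
  shows "Td_le_pi p \<xi> \<eta>"
proof -
  interpret proper_busemann p
    by unfold_locales (rule proper)
  obtain c where c: "is_ray c" "ray_end c = \<zeta>" "\<And>t. 0 \<le> t \<Longrightarrow> \<Phi> (c t) \<le> \<Phi> (c 0)"
    using Td_le_half_piD[OF Td_\<Phi>] by blast
  obtain d where d: "is_ray d" "ray_end d = \<zeta>" "\<And>t. 0 \<le> t \<Longrightarrow> \<Psi> (d t) \<le> \<Psi> (d 0)"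
    using Td_le_half_piD[OF Td_\<Psi>] by blast
  have "convex_lipschitz \<Psi>"
    using \<Psi> by (auto simp: horofunction_def hboundary_def intro: convex_lipschitz_hcompact)
  moreover have "(c, d) \<in> asymptotic"
    using c d by (intro ray_end_eqD) auto
  ultimately obtain D where D: "\<And>t. 0 \<le> t \<Longrightarrow> \<Psi> (c t) \<le> \<Psi> (d 0) + D"
    by (rule bounded_above_on_asymptotic_ray) (use d(3) in auto)
  \<comment> \<open>One nonnegative bound for both functions relative to their values at
    \<open>p\<close>; for \<Psi> it includes the passage from \<open>d\<close> to
    \<open>c\<close>.\<close>
  define E where "E = max 0 (max (\<Phi> (c 0) - \<Phi> p) (\<Psi> (d 0) + D - \<Psi> p))"
  show ?thesis
  proof (rule Td_le_pi_if_bounded_on_ray[OF \<Phi> \<Psi> \<xi> \<eta> c(1)])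
    show "0 \<le> E"
      by (simp add: E_def)
    show "\<Phi> (c t) \<le> \<Phi> p + E" "\<Psi> (c t) \<le> \<Psi> p + E" if "0 \<le> t" for t
      using c(3)[OF that] D[OF that] by (auto simp: E_def)
  qed
qed

end
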